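(* Let $\Gamma$ be a discrete group satisfying the approximation property which acts freely on a compact Hausdorff space $X$. Then the map $$H \mapsto \overline{\operatorname{span}}\{ f u_g \colon g\in\Gamma,\ f\in C(X),\ \operatorname{supp}(f) \subseteq \pi_g(H) \}$$ defines a one-to-one correspondence between open subgroupoids $H \subseteq \Gamma \times X$ with $\{e\} \times X \subseteq H$ and intermediate C$^*$-algebras $B$ with $C(X) \subseteq B \subseteq C(X) \rtimes_r \Gamma$.
   Context: $\Gamma$ acts on $X$ by homeomorphisms. $\Gamma\times X$ is the transformation groupoid, with partial multiplication $(g_1,g_2\cdot x)(g_2,x)=(g_1g_2,x)$, inverse $(g,x)^{-1}=(g^{-1},g\cdot x)$, and the product topology ($\Gamma$ discrete). $C(X)$ is viewed as a subalgebra of the reduced crossed product $C(X)\rtimes_r\Gamma$, and $\{u_g\}_{g\in\Gamma}$ denotes the canonical unitary representation of $\Gamma$ in $C(X)\rtimes_r\Gamma$. The action is free if for each $g\ne e$ in $\Gamma$ the set $\{x\in X: g\cdot x=x\}$ is empty. For $g\in\Gamma$ and $U\subseteq\Gamma\times X$, $\pi_g(U)=\{x\in X:(g,x)\in U\}$. Here $\operatorname{supp}(f)=\{x\in X: f(x)\neq 0\}$. Approximation property: a discrete group $\Gamma$ has the approximation property if the constant function $1$ is in the weak$^*$-closure of the space of finitely supported functions on $\Gamma$; explicitly, if there exists a net $(f_\alpha)$ of finitely supported functions on $\Gamma$ such that for every $\varphi\in\ell^1(\Gamma)$, $\sum_{\gamma\in\Gamma}\varphi(\gamma)f_\alpha(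\gamma)\to\sum_{\gamma\in\Gamma}\varphi(\gamma)$.
   Formalization: The approximation property is Haagerup–Kraus's: the weak* topology of the cb multipliers, not just testing against ℓ¹(Γ), which every group passes. Products are u_g f instead of f u_g, since with π_g(H) consisting of sources the span of f u_g need not be closed under adjoints. *)

theory Defs
  imports "HOL-Analysis.Analysis"
begin

section \<open>The complex Hilbert space of square-summable families\<close>

typedef 'i ell2 = "{\<xi> :: 'i \<Rightarrow> complex. (\<lambda>i. (cmod (\<xi> i))\<^sup>2) summable_on UNIV}"
  morphisms ell2_apply Abs_ell2
  by (rule exI[of _ "\<lambda>_. 0"]) simp

setup_lifting type_definition_ell2

lemma ell2_eqI: "(\<And>i. ell2_apply \<xi> i = ell2_apply \<eta> i) \<Longrightarrow> \<xi> = \<eta>"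
  by (simp add: ell2_apply_inject[symmetric] fun_eq_iff)

lemma square_summable_add:
  fixes \<xi> \<eta> :: "'i \<Rightarrow> complex"
  assumes "(\<lambda>i. (cmod (\<xi> i))\<^sup>2) summable_on UNIV" "(\<lambda>i. (cmod (\<eta> i))\<^sup>2) summable_on UNIV"
  shows "(\<lambda>i. (cmod (\<xi> i + \<eta> i))\<^sup>2) summable_on UNIV"
proof (rule summable_on_comparison_test)
  show "(\<lambda>i. 2 * (cmod (\<xi> i))\<^sup>2 + 2 * (cmod (\<eta> i))\<^sup>2) summable_on UNIV"
    by (intro summable_on_add summable_on_cmult_right assms)
  fix i
  have "(cmod (\<xi> i + \<eta> i))\<^sup>2 \<le> (cmod (\<xi> i) + cmod (\<eta> i))\<^sup>2"
    by (intro power_mono norm_triangle_ineq) auto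
  also have "\<dots> \<le> 2 * (cmod (\<xi> i))\<^sup>2 + 2 * (cmod (\<eta> i))\<^sup>2"
    using sum_squares_bound[of "cmod (\<xi> i)" "cmod (\<eta> i)"] by (simp add: power2_sum)
  finally show "(cmod (\<xi> i + \<eta> i))\<^sup>2 \<le> 2 * (cmod (\<xi> i))\<^sup>2 + 2 * (cmod (\<eta> i))\<^sup>2" .
qed auto

lemma square_summable_mult:
  fixes a \<xi> :: "'i \<Rightarrow> complex"
  assumes "(\<lambda>i. (cmod (\<xi> i))\<^sup>2) summable_on UNIV" "\<And>i. cmod (a i) \<le> K"
  shows "(\<lambda>i. (cmod (a i * \<xi> i))\<^sup>2) summable_on UNIV"
proof (rule summable_on_comparison_test)
  show "(\<lambda>i. K\<^sup>2 * (cmod (\<xi> i))\<^sup>2) summable_on UNIV"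
    by (intro summable_on_cmult_right assms)
  fix i
  show "(cmod (a i * \<xi> i))\<^sup>2 \<le> K\<^sup>2 * (cmod (\<xi> i))\<^sup>2"
    unfolding norm_mult power_mult_distrib
    by (intro mult_right_mono power_mono assms) auto
qed auto

lemma cnj_mult_summable:
  fixes \<xi> \<eta> :: "'i \<Rightarrow> complex"
  assumes "(\<lambda>i. (cmod (\<xi> i))\<^sup>2) summable_on UNIV" "(\<lambda>i. (cmod (\<eta> i))\<^sup>2) summable_on UNIV"
  shows "(\<lambda>i. cnj (\<xi> i) * \<eta> i) summable_on UNIV"
proof -
  have "(\<lambda>i. norm (cnj (\<xi> i) * \<eta> i)) summable_on UNIV"
    by (rule abs_summable_product) (use assms in \<open>simp_all add: norm_mult power2_eq_square\<close>)
  then show ?thesis by (rule abs_summable_summable)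
qed

instantiation ell2 :: (type) real_vector
begin
lift_definition zero_ell2 :: "'a ell2" is "\<lambda>_. 0" by simp
lift_definition plus_ell2 :: "'a ell2 \<Rightarrow> 'a ell2 \<Rightarrow> 'a ell2" is "\<lambda>\<xi> \<eta> i. \<xi> i + \<eta> i"
  by (rule square_summable_add)
lift_definition uminus_ell2 :: "'a ell2 \<Rightarrow> 'a ell2" is "\<lambda>\<xi> i. - \<xi> i" by simp
lift_definition minus_ell2 :: "'a ell2 \<Rightarrow> 'a ell2 \<Rightarrow> 'a ell2" is "\<lambda>\<xi> \<eta> i. \<xi> i - \<eta> i"
  subgoal for \<xi> \<eta> using square_summable_add[of \<xi> "\<lambda>i. - \<eta> i"] by simp
  done
lift_definition scaleR_ell2 :: "real \<Rightarrow> 'a ell2 \<Rightarrow> 'a ell2" is "\<lambda>r \<xi> i. of_real r * \<xi> i"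
  subgoal for r \<xi> by (rule square_summable_mult[where K="\<bar>r\<bar>"]) auto
  done
instance
  by standard (transfer; simp add: algebra_simps fun_eq_iff)+
end

lift_definition cinner_ell2 :: "'i ell2 \<Rightarrow> 'i ell2 \<Rightarrow> complex"
  is "\<lambda>\<xi> \<eta>. \<Sum>\<^sub>\<infinity>i. cnj (\<xi> i) * \<eta> i" .

lemma Re_cinner_ell2_self: "Re (cinner_ell2 \<xi> \<xi>) = (\<Sum>\<^sub>\<infinity>i. (cmod (ell2_apply \<xi> i))\<^sup>2)"
proof -
  have "(\<lambda>i. cnj (ell2_apply \<xi> i) * ell2_apply \<xi> i) summable_on UNIV"
    using ell2_apply[of \<xi>] by (auto intro: cnj_mult_summable)
  then have "Re (cinner_ell2 \<xi> \<xi>) = (\<Sum>\<^sub>\<infinity>i. Re (cnj (ell2_apply \<xi> i) * ell2_apply \<xi> i))"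
    unfolding cinner_ell2.rep_eq by (rule infsum_Re[symmetric])
  also have "\<dots> = (\<Sum>\<^sub>\<infinity>i. (cmod (ell2_apply \<xi> i))\<^sup>2)"
    by (rule infsum_cong) (metis complex_norm_square mult.commute Re_complex_of_real)
  finally show ?thesis .
qed

text \<open>The real inner product is the real part of the complex one, so both induce the same norm.\<close>

instantiation ell2 :: (type) real_inner
begin
definition inner_ell2 :: "'a ell2 \<Rightarrow> 'a ell2 \<Rightarrow> real" where
  "inner_ell2 \<xi> \<eta> = Re (cinner_ell2 \<xi> \<eta>)"
definition norm_ell2 :: "'a ell2 \<Rightarrow> real" where
  "norm_ell2 \<xi> = sqrt (inner \<xi> \<xi>)"
definition sgn_ell2 :: "'a ell2 \<Rightarrow> 'a ell2" where
  "sgn_ell2 \<xi> = \<xi> /\<^sub>R norm \<xi>"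
definition dist_ell2 :: "'a ell2 \<Rightarrow> 'a ell2 \<Rightarrow> real" where
  "dist_ell2 \<xi> \<eta> = norm (\<xi> - \<eta>)"
definition uniformity_ell2 :: "('a ell2 \<times> 'a ell2) filter" where
  "uniformity_ell2 = (INF e\<in>{0<..}. principal {(x, y). dist x y < e})"
definition open_ell2 :: "'a ell2 set \<Rightarrow> bool" where
  "open_ell2 U \<longleftrightarrow> (\<forall>x\<in>U. eventually (\<lambda>(x', y). x' = x \<longrightarrow> y \<in> U) uniformity)"
instance
proof
  fix x y z :: "'a ell2" and r :: real
  have sm: "(\<lambda>i. cnj (ell2_apply u i) * ell2_apply v i) summable_on UNIV" for u v :: "'a ell2"
    using ell2_apply[of u] ell2_apply[of v] by (auto intro: cnj_mult_summable)
  show "inner x y = inner y x"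
  proof -
    have "cinner_ell2 x y = cnj (cinner_ell2 y x)"
      unfolding cinner_ell2.rep_eq infsum_cnj[symmetric] by (intro infsum_cong) simp
    then show ?thesis by (simp add: inner_ell2_def)
  qed
  show "inner (x + y) z = inner x z + inner y z"
    unfolding inner_ell2_def cinner_ell2.rep_eq plus_ell2.rep_eq
    by (simp add: distrib_right infsum_add sm)
  show "inner (r *\<^sub>R x) y = r * inner x y"
    unfolding inner_ell2_def cinner_ell2.rep_eq scaleR_ell2.rep_eq
    by (simp add: mult.assoc infsum_cmult_right')
  show "0 \<le> inner x x"
    unfolding inner_ell2_def Re_cinner_ell2_self by (intro infsum_nonneg) auto
  show "inner x x = 0 \<longleftrightarrow> x = 0"
  proof
    assume "inner x x = 0"
    then have 0: "(\<Sum>\<^sub>\<infinity>i. (cmod (ell2_apply x i))\<^sup>2) = 0"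
      by (simp add: inner_ell2_def Re_cinner_ell2_self)
    have "(cmod (ell2_apply x i))\<^sup>2 = 0" for i
      by (rule nonneg_infsum_le_0D[where A=UNIV and f="\<lambda>i. (cmod (ell2_apply x i))\<^sup>2"])
        (use 0 ell2_apply[of x] in auto)
    then show "x = 0" by (intro ell2_eqI) (simp add: zero_ell2.rep_eq)
  next
    assume "x = 0" then show "inner x x = 0"
      by (simp add: inner_ell2_def cinner_ell2.rep_eq zero_ell2.rep_eq)
  qed
qed (simp_all add: norm_ell2_def sgn_ell2_def dist_ell2_def uniformity_ell2_def open_ell2_def)
end

lemma norm_ell2_eq: "norm \<xi> = sqrt (\<Sum>\<^sub>\<infinity>i. (cmod (ell2_apply \<xi> i))\<^sup>2)"
  by (simp add: norm_ell2_def inner_ell2_def Re_cinner_ell2_self)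


section \<open>Operators\<close>

text \<open>
  The ambient type \<open>'i ell2 \<Rightarrow>\<^sub>L 'i ell2\<close> consists of the bounded \<^emph>\<open>real\<close>-linear operators with the
  operator norm.  All operators below are complex linear, and the complex-linear ones form a
  norm-closed subalgebra, so no closure formed below leaves it.
\<close>

type_synonym 'i op = "'i ell2 \<Rightarrow>\<^sub>L 'i ell2"

text \<open>
  The weighted composition operator \<open>(W \<xi>)(i) = a(i) \<xi>(\<sigma>(i))\<close>.  It is bounded, and \<^const>\<open>Blinfun\<close>
  meaningful, whenever \<open>a\<close> is bounded and \<open>\<sigma>\<close> is injective where \<open>a\<close> does not vanish.
\<close>

definition weighted_comp :: "('i \<Rightarrow> complex) \<Rightarrow> ('i \<Rightarrow> 'i) \<Rightarrow> 'i op" where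
  "weighted_comp a \<sigma> = Blinfun (\<lambda>\<xi>. Abs_ell2 (\<lambda>i. a i * ell2_apply \<xi> (\<sigma> i)))"

lemma weighted_comp_apply:
  assumes a: "\<And>i. cmod (a i) \<le> K" and inj: "inj_on \<sigma> {i. a i \<noteq> 0}"
  shows "ell2_apply (blinfun_apply (weighted_comp a \<sigma>) \<xi>) i = a i * ell2_apply \<xi> (\<sigma> i)"
proof -
  define S where "S = {i. a i \<noteq> 0}"
  have K: "K \<ge> 0" using a[of undefined] norm_ge_zero order_trans by blast
  have xi: "(\<lambda>i. (cmod (ell2_apply \<xi> i))\<^sup>2) summable_on UNIV" for \<xi> :: "'a ell2"
    using ell2_apply[of \<xi>] by simp
  have s1: "(\<lambda>i. (cmod (ell2_apply \<xi> (\<sigma> i)))\<^sup>2) summable_on S" for \<xi>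
  proof -
    have "(\<lambda>i. (cmod (ell2_apply \<xi> i))\<^sup>2) summable_on (\<sigma> ` S)"
      using summable_on_subset[OF xi] by auto
    then show ?thesis using inj by (simp add: summable_on_reindex S_def o_def)
  qed
  have s2: "(\<lambda>i. (cmod (a i * ell2_apply \<xi> (\<sigma> i)))\<^sup>2) summable_on S" for \<xi>
  proof (rule summable_on_comparison_test)
    show "(\<lambda>i. K\<^sup>2 * (cmod (ell2_apply \<xi> (\<sigma> i)))\<^sup>2) summable_on S"
      by (intro summable_on_cmult_right s1)
  qed (auto simp: norm_mult power_mult_distrib intro!: mult_right_mono power_mono a)
  have s3: "(\<lambda>i. (cmod (a i * ell2_apply \<xi> (\<sigma> i)))\<^sup>2) summable_on UNIV" for \<xi>
    using s2[of \<xi>] by (rule summable_on_cong_neutral[THEN iffD1, rotated 3]) (auto simp: S_def)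
  let ?T = "\<lambda>\<xi>. Abs_ell2 (\<lambda>i. a i * ell2_apply \<xi> (\<sigma> i))"
  have T: "ell2_apply (?T \<xi>) i = a i * ell2_apply \<xi> (\<sigma> i)" for \<xi> i
    using s3[of \<xi>] by (simp add: Abs_ell2_inverse)
  have bound: "norm (?T \<xi>) \<le> norm \<xi> * K" for \<xi>
  proof -
    have "(\<Sum>\<^sub>\<infinity>i. (cmod (a i * ell2_apply \<xi> (\<sigma> i)))\<^sup>2) = (\<Sum>\<^sub>\<infinity>i\<in>S. (cmod (a i * ell2_apply \<xi> (\<sigma> i)))\<^sup>2)"
      by (intro infsum_cong_neutral) (auto simp: S_def)
    also have "\<dots> \<le> (\<Sum>\<^sub>\<infinity>i\<in>S. K\<^sup>2 * (cmod (ell2_apply \<xi> (\<sigma> i)))\<^sup>2)"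
      by (intro infsum_mono s2 summable_on_cmult_right s1)
        (auto simp: norm_mult power_mult_distrib intro!: mult_right_mono power_mono a)
    also have "\<dots> = K\<^sup>2 * (\<Sum>\<^sub>\<infinity>i\<in>S. (cmod (ell2_apply \<xi> (\<sigma> i)))\<^sup>2)"
      by (simp add: infsum_cmult_right')
    also have "(\<Sum>\<^sub>\<infinity>i\<in>S. (cmod (ell2_apply \<xi> (\<sigma> i)))\<^sup>2) = (\<Sum>\<^sub>\<infinity>i\<in>\<sigma> ` S. (cmod (ell2_apply \<xi> i))\<^sup>2)"
      using inj by (simp add: infsum_reindex S_def o_def)
    also have "\<dots> \<le> (\<Sum>\<^sub>\<infinity>i. (cmod (ell2_apply \<xi> i))\<^sup>2)"
      by (intro infsum_mono_neutral summable_on_subset[OF xi] xi) auto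
    finally have "sqrt (\<Sum>\<^sub>\<infinity>i. (cmod (a i * ell2_apply \<xi> (\<sigma> i)))\<^sup>2)
        \<le> sqrt (K\<^sup>2 * (\<Sum>\<^sub>\<infinity>i. (cmod (ell2_apply \<xi> i))\<^sup>2))"
      by (simp add: mult_left_mono)
    then show ?thesis using K by (simp add: norm_ell2_eq T real_sqrt_mult mult.commute)
  qed
  have "bounded_linear ?T"
  proof (rule bounded_linear_intro[where K=K])
    show "?T (x + y) = ?T x + ?T y" for x y
    proof (rule ell2_eqI)
      fix i
      have "ell2_apply (?T (x + y)) i = a i * (ell2_apply x (\<sigma> i) + ell2_apply y (\<sigma> i))"
        by (rule trans[OF T]) (simp only: plus_ell2.rep_eq)
      also have "\<dots> = ell2_apply (?T x) i + ell2_apply (?T y) i"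
        by (simp only: T distrib_left)
      also have "\<dots> = ell2_apply (?T x + ?T y) i"
        by (simp only: plus_ell2.rep_eq)
      finally show "ell2_apply (?T (x + y)) i = ell2_apply (?T x + ?T y) i" .
    qed
    show "?T (r *\<^sub>R x) = r *\<^sub>R ?T x" for r x
    proof (rule ell2_eqI)
      fix i
      have "ell2_apply (?T (r *\<^sub>R x)) i = a i * (of_real r * ell2_apply x (\<sigma> i))"
        by (rule trans[OF T]) (simp only: scaleR_ell2.rep_eq)
      also have "\<dots> = of_real r * ell2_apply (?T x) i"
        by (simp only: T mult.left_commute)
      also have "\<dots> = ell2_apply (r *\<^sub>R ?T x) i"
        by (simp only: scaleR_ell2.rep_eq)
      finally show "ell2_apply (?T (r *\<^sub>R x)) i = ell2_apply (r *\<^sub>R ?T x) i" .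
    qed
  qed (rule bound)
  then show ?thesis
    unfolding weighted_comp_def by (simp add: bounded_linear_Blinfun_apply T)
qed

definition op_scaleC :: "complex \<Rightarrow> 'i op \<Rightarrow> 'i op" where
  "op_scaleC c T = weighted_comp (\<lambda>_. c) id o\<^sub>L T"

lemma op_scaleC_apply:
  "ell2_apply (blinfun_apply (op_scaleC c T) \<xi>) i = c * ell2_apply (blinfun_apply T \<xi>) i"
  unfolding op_scaleC_def by (simp add: weighted_comp_apply[where K="cmod c"])

global_interpretation op: vector_space op_scaleC
  defines op_span = op.span and op_subspace = op.subspace
  by standard (auto intro!: blinfun_eqI ell2_eqI
      simp: op_scaleC_apply blinfun.add_left plus_ell2.rep_eq algebra_simps)

definition is_adjoint :: "'i op \<Rightarrow> 'i op \<Rightarrow> bool" where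
  "is_adjoint T S \<longleftrightarrow> (\<forall>\<xi> \<eta>. cinner_ell2 \<xi> (blinfun_apply T \<eta>) = cinner_ell2 (blinfun_apply S \<xi>) \<eta>)"

definition cstar_subalgebra :: "'i op set \<Rightarrow> bool" where
  "cstar_subalgebra B \<longleftrightarrow> op_subspace B \<and> closed B
     \<and> (\<forall>S\<in>B. \<forall>T\<in>B. S o\<^sub>L T \<in> B)
     \<and> (\<forall>T\<in>B. \<exists>S\<in>B. is_adjoint T S)"


section \<open>The approximation property\<close>

text \<open>
  A discrete group is a type of class \<^class>\<open>group_add\<close>, i.e. a group written additively that need
  not be commutative; \<open>0\<close> is the identity \<open>e\<close> and \<open>g + h\<close> the product \<open>gh\<close>.
\<close>

definition finite_support :: "('i \<Rightarrow> complex) \<Rightarrow> bool" where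
  "finite_support a \<longleftrightarrow> finite {i. a i \<noteq> 0}"

text \<open>\<open>e\<^sub>i\<^sub>j \<otimes> \<lambda>(g)\<close> on \<open>\<ell>\<^sup>2(\<nat>) \<otimes> \<ell>\<^sup>2(\<Gamma>) = \<ell>\<^sup>2(\<nat> \<times> \<Gamma>)\<close>, with \<open>\<lambda>\<close> the left regular representation.\<close>

definition unit_reg :: "nat \<Rightarrow> nat \<Rightarrow> 'g \<Rightarrow> (nat \<times> 'g::group_add) op" where
  "unit_reg i j g = weighted_comp (\<lambda>(k, s). if k = i then 1 else 0) (\<lambda>(k, s). (j, - g + s))"

lemma unit_reg_apply:
  "ell2_apply (blinfun_apply (unit_reg i j g) \<xi>) (k, s)
     = (if k = i then ell2_apply \<xi> (j, - g + s) else 0)"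
proof -
  have "inj_on (\<lambda>(k, s). (j, - g + s)) {z. (case z of (k, s) \<Rightarrow> if k = i then 1 else (0::complex)) \<noteq> 0}"
    by (auto simp: inj_on_def split: if_splits)
  then show ?thesis
    unfolding unit_reg_def by (subst weighted_comp_apply[where K=1]) auto
qed

text \<open>The matrix \<open>(\<Sum>\<^sub>g a\<^sub>i\<^sub>j(g) \<lambda>(g))\<^sub>i\<^sub>,\<^sub>j\<^sub><\<^sub>n\<close> in \<open>M\<^sub>n(\<complex>[\<Gamma>]) \<subseteq> M\<^sub>n(C\<^sup>*\<^sub>r(\<Gamma>))\<close>.\<close>

definition reg_matrix :: "nat \<Rightarrow> (nat \<Rightarrow> nat \<Rightarrow> 'g \<Rightarrow> complex) \<Rightarrow> (nat \<times> 'g::group_add) op" where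
  "reg_matrix n a = (\<Sum>i<n. \<Sum>j<n. \<Sum>g | a i j g \<noteq> 0. op_scaleC (a i j g) (unit_reg i j g))"

text \<open>
  \<open>cb_multiplier_bound \<phi> C\<close>: the map \<open>\<lambda>(g) \<mapsto> \<phi>(g) \<lambda>(g)\<close> extends to a completely bounded map of
  \<open>C\<^sup>*\<^sub>r(\<Gamma>)\<close> with cb-norm at most \<open>C\<close>.  By density it suffices to bound its amplifications on \<open>\<complex>[\<Gamma>]\<close>.
  The functions admitting such a bound form the space \<open>M\<^sub>0A(\<Gamma>)\<close>.
\<close>

definition cb_multiplier_bound :: "('g::group_add \<Rightarrow> complex) \<Rightarrow> real \<Rightarrow> bool" where
  "cb_multiplier_bound \<phi> C \<longleftrightarrow> 0 \<le> C \<and>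
     (\<forall>n a. (\<forall>i<n. \<forall>j<n. finite_support (a i j)) \<longrightarrow>
        norm (reg_matrix n (\<lambda>i j g. \<phi> g * a i j g)) \<le> C * norm (reg_matrix n a))"

definition cb_multiplier :: "('g::group_add \<Rightarrow> complex) \<Rightarrow> bool" where
  "cb_multiplier \<phi> \<longleftrightarrow> (\<exists>C. cb_multiplier_bound \<phi> C)"

definition cb_multiplier_norm :: "('g::group_add \<Rightarrow> complex) \<Rightarrow> real" where
  "cb_multiplier_norm \<phi> = Inf {C. cb_multiplier_bound \<phi> C}"

text \<open>
  The predual \<open>Q(\<Gamma>)\<close> of \<open>M\<^sub>0A(\<Gamma>)\<close>: the norm closure in \<open>M\<^sub>0A(\<Gamma>)\<^sup>*\<close> of the functionals
  \<open>\<phi> \<mapsto> \<Sum>\<^sub>g a(g) \<phi>(g)\<close> with \<open>a \<in> \<ell>\<^sup>1(\<Gamma>)\<close>.  Such functionals are only specified on \<open>M\<^sub>0A(\<Gamma>)\<close>.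
\<close>

definition predual_functional :: "(('g::group_add \<Rightarrow> complex) \<Rightarrow> complex) \<Rightarrow> bool" where
  "predual_functional \<omega> \<longleftrightarrow> (\<forall>\<epsilon>>0. \<exists>a. (\<lambda>g. cmod (a g)) summable_on UNIV \<and>
     (\<forall>\<phi>. cb_multiplier \<phi> \<longrightarrow> cmod (\<omega> \<phi> - (\<Sum>\<^sub>\<infinity>g. a g * \<phi> g)) \<le> \<epsilon> * cb_multiplier_norm \<phi>))"

text \<open>
  The approximation property of Haagerup and Kraus: \<open>1\<close> lies in the \<open>\<sigma>(M\<^sub>0A(\<Gamma>), Q(\<Gamma>))\<close>-closure of the
  finitely supported functions (which all belong to \<open>M\<^sub>0A(\<Gamma>)\<close>).  The net is given as a proper
  filter of functions.  Testing against the dense subspace \<open>\<ell>\<^sup>1(\<Gamma>)\<close> of \<open>Q(\<Gamma>)\<close> only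
  would not do: the net need not be bounded, and the indicator functions of the finite subsets
  converge to \<open>1\<close> against \<open>\<ell>\<^sup>1(\<Gamma>)\<close> for every group.
\<close>

definition approximation_property :: "'g::group_add itself \<Rightarrow> bool" where
  "approximation_property _ \<longleftrightarrow> (\<exists>F :: ('g \<Rightarrow> complex) filter. F \<noteq> bot \<and>
     eventually finite_support F \<and>
     (\<forall>\<omega>. predual_functional \<omega> \<longrightarrow> (\<omega> \<longlongrightarrow> \<omega> (\<lambda>_. 1)) F))"


section \<open>Actions, the transformation groupoid and the reduced crossed product\<close>

definition action_by_homeomorphisms :: "('g::group_add \<Rightarrow> 'x::topological_space \<Rightarrow> 'x) \<Rightarrow> bool" where
  "action_by_homeomorphisms act \<longleftrightarrow>
     (\<forall>x. act 0 x = x) \<and> (\<forall>g h x. act (g + h) x = act g (act h x)) \<and>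
     (\<forall>g. homeomorphism UNIV UNIV (act g) (act (- g)))"

definition free_action :: "('g::group_add \<Rightarrow> 'x \<Rightarrow> 'x) \<Rightarrow> bool" where
  "free_action act \<longleftrightarrow> (\<forall>g. g \<noteq> 0 \<longrightarrow> {x. act g x = x} = {})"

text \<open>In the transformation groupoid \<open>\<Gamma> \<times> X\<close> the arrow \<open>(g, x)\<close> has source \<open>x\<close> and range \<open>g \<cdot> x\<close>.\<close>

definition subgroupoid :: "('g::group_add \<Rightarrow> 'x \<Rightarrow> 'x) \<Rightarrow> ('g \<times> 'x) set \<Rightarrow> bool" where
  "subgroupoid act H \<longleftrightarrow>
     (\<forall>g x. (g, x) \<in> H \<longrightarrow> (- g, act g x) \<in> H) \<and>
     (\<forall>g h x. (g, act h x) \<in> H \<longrightarrow> (h, x) \<in> H \<longrightarrow> (g + h, x) \<in> H)"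

definition groupoid_open :: "('g \<times> 'x::topological_space) set \<Rightarrow> bool" where
  "groupoid_open H \<longleftrightarrow> openin (prod_topology (discrete_topology UNIV) euclidean) H"

definition fibre :: "'g \<Rightarrow> ('g \<times> 'x) set \<Rightarrow> 'x set" where
  "fibre g U = {x. (g, x) \<in> U}"

definition supp :: "('x \<Rightarrow> complex) \<Rightarrow> 'x set" where
  "supp f = {x. f x \<noteq> 0}"

text \<open>
  The regular representation on \<open>\<ell>\<^sup>2(\<Gamma> \<times> X) = \<ell>\<^sup>2(\<Gamma>) \<otimes> \<ell>\<^sup>2(X)\<close> induced from the faithful representation
  of \<open>C(X)\<close> by multiplication on \<open>\<ell>\<^sup>2(X)\<close>:
  \<open>(f \<xi>)(h, x) = f(h \<cdot> x) \<xi>(h, x)\<close> and \<open>(u\<^sub>g \<xi>)(h, x) = \<xi>(g\<^sup>-\<^sup>1h, x)\<close>.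
  Then \<open>u\<^sub>g f u\<^sub>g\<^sup>* = f(g\<^sup>-\<^sup>1 \<cdot> _)\<close>.
\<close>

definition func_op :: "('g::group_add \<Rightarrow> 'x \<Rightarrow> 'x) \<Rightarrow> ('x \<Rightarrow> complex) \<Rightarrow> ('g \<times> 'x) op" where
  "func_op act f = weighted_comp (\<lambda>(h, x). f (act h x)) id"

definition unitary_op :: "'g::group_add \<Rightarrow> ('g \<times> 'x) op" where
  "unitary_op g = weighted_comp (\<lambda>_. 1) (\<lambda>(h, x). (- g + h, x))"

lemma func_op_apply:
  assumes "compact (UNIV :: 'x::topological_space set)" "continuous_on UNIV (f :: 'x \<Rightarrow> complex)"
  shows "ell2_apply (blinfun_apply (func_op act f) \<xi>) (h, x) = f (act h x) * ell2_apply \<xi> (h, x)"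
proof -
  have "bounded (range f)"
    using assms compact_continuous_image compact_imp_bounded by blast
  then obtain K where "\<And>x. cmod (f x) \<le> K" unfolding bounded_iff by blast
  then show ?thesis unfolding func_op_def by (subst weighted_comp_apply[where K=K]) auto
qed

lemma unitary_op_apply:
  "ell2_apply (blinfun_apply (unitary_op g) \<xi>) (h, x) = ell2_apply \<xi> (- g + h, x)"
  unfolding unitary_op_def by (subst weighted_comp_apply[where K=1]) (auto simp: inj_on_def)

lemma covariance:
  assumes "compact (UNIV :: 'x::topological_space set)" "continuous_on UNIV (f :: 'x \<Rightarrow> complex)"
    and "action_by_homeomorphisms act"
  shows "unitary_op g o\<^sub>L func_op act f = func_op act (\<lambda>x. f (act (- g) x)) o\<^sub>L unitary_op g"
proof -
  have act: "act (a + b) x = act a (act b x)" for a b x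
    using assms(3) by (simp add: action_by_homeomorphisms_def)
  have "continuous_on UNIV (act (- g))"
    using assms(3) by (auto simp: action_by_homeomorphisms_def homeomorphism_def)
  then have "continuous_on UNIV (\<lambda>x. f (act (- g) x))"
    using assms(2) by (auto intro: continuous_on_compose2)
  then show ?thesis
    by (intro blinfun_eqI ell2_eqI) (auto simp: func_op_apply assms(1,2) unitary_op_apply act)
qed

definition CX :: "('g::group_add \<Rightarrow> 'x::topological_space \<Rightarrow> 'x) \<Rightarrow> ('g \<times> 'x) op set" where
  "CX act = {func_op act f | f. continuous_on UNIV f}"

definition reduced_crossed_product ::
  "('g::group_add \<Rightarrow> 'x::topological_space \<Rightarrow> 'x) \<Rightarrow> ('g \<times> 'x) op set" where
  "reduced_crossed_product act =
     closure (op_span {func_op act f o\<^sub>L unitary_op g | g f. continuous_on UNIV f})"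

text \<open>
  In the convolution algebra of \<open>\<Gamma> \<times> X\<close> (with \<open>(g, x)\<close> having source \<open>x\<close>), the function \<open>f\<close> placed on
  the slice \<open>{g} \<times> X\<close> is the operator product \<open>u\<^sub>g f\<close>, whereas \<open>f u\<^sub>g\<close> is \<open>f(g \<cdot> _)\<close> on that slice.
  The set \<^term>\<open>fibre g H\<close> collects sources of arrows.  Hence the elements supported in \<open>H\<close> are the
  \<open>u\<^sub>g f\<close> with \<^prop>\<open>supp f \<subseteq> fibre g H\<close>; with \<open>f u\<^sub>g\<close> in their place the span need not
  be closed under adjoints.
\<close>

end

theory Submission
  imports Defs
begin

text \<open>
  Every operator \<open>T\<close> has coefficient functions \<open>coef T g\<close> on \<open>X\<close>, which are continuous for \<open>T\<close> in the
  crossed product, and \<open>T\<close> is formally the sum of its slices \<open>u\<^sub>g coef T g\<close>.  An algebra \<open>B\<close> is sent back to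
  the set of arrows \<open>(g, x)\<close> with \<open>coef T g x \<noteq> 0\<close> for some \<open>T\<close> in \<open>B\<close>.  That this recovers an open \<open>H\<close>
  from the algebra of \<open>H\<close> is Urysohn's lemma.  That it recovers \<open>B\<close>, and that the set of arrows is
  a subgroupoid, rests on two facts, one for each hypothesis on the group and the action.

  Freeness puts every slice of a member of \<open>B\<close> into \<open>B\<close> (\<open>slice_coef_in_B\<close>).  Take continuous functions
  \<open>l\<^sub>i\<close> whose squares sum to \<open>1\<close> and whose supports are so small that they are moved off themselves by
  finitely many given group elements.  The contractive map taking \<open>T\<close> to the sum of the operators
  \<open>(l\<^sub>i \<circ> g\<^sup>-\<^sup>1) T l\<^sub>i\<close> keeps the slice at \<open>g\<close> and kills finitely many others.  So the slices at \<open>g\<close> in \<open>B\<close> form a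
  closed ideal of \<open>C(X)\<close>, and a closed ideal is determined by the open set where it does not vanish.

  The approximation property puts \<open>T\<close> into the closed span of its own slices
  (\<open>in_closure_span_slice_coef\<close>).  A functional \<open>\<psi>\<close> vanishing on the slices gives an element
  \<open>\<phi> \<mapsto> \<psi> (M\<^sub>\<phi> T)\<close> of the predual of the completely bounded multipliers, where \<open>M\<^sub>\<phi>\<close> multiplies the slice
  at \<open>g\<close> by \<open>\<phi> g\<close>; it vanishes at the finitely supported \<open>\<phi>\<close>, hence also at \<open>1\<close>.  The norm of \<open>M\<^sub>\<phi>\<close> is at
  most the completely bounded norm of \<open>\<phi>\<close> because over each point of \<open>X\<close> the crossed product acts by
  matrices indexed by the group, on which \<open>M\<^sub>\<phi>\<close> is Schur multiplication by \<open>\<phi> (s - t)\<close>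
  (\<open>schur_multiplier_bound\<close>).  That a closed subspace not containing \<open>T\<close> has such a functional \<open>\<psi>\<close> is the
  Hahn--Banach theorem, obtained from minimal sublinear functionals.
\<close>


section \<open>Square-summable families\<close>

lemma ell2_summable: "(\<lambda>i. (cmod (ell2_apply \<xi> i))\<^sup>2) summable_on UNIV"
  using ell2_apply[of \<xi>] by simp

lemma norm_ell2_sq: "(norm \<xi>)\<^sup>2 = (\<Sum>\<^sub>\<infinity>i. (cmod (ell2_apply \<xi> i))\<^sup>2)"
  unfolding norm_ell2_eq by (rule real_sqrt_pow2) (auto intro: infsum_nonneg)

lemma sum_le_norm_ell2_sq:
  assumes "finite F"
  shows "(\<Sum>i\<in>F. (cmod (ell2_apply \<xi> i))\<^sup>2) \<le> (norm \<xi>)\<^sup>2"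
  unfolding norm_ell2_sq by (rule finite_sum_le_infsum) (auto intro: ell2_summable assms)

lemma cmod_ell2_apply_le: "cmod (ell2_apply \<xi> i) \<le> norm \<xi>"
  using sum_le_norm_ell2_sq[of "{i}" \<xi>] by (simp add: power2_le_iff_abs_le)

lemma norm_ell2_leI:
  assumes "0 \<le> C" "\<And>F. finite F \<Longrightarrow> (\<Sum>i\<in>F. (cmod (ell2_apply \<xi> i))\<^sup>2) \<le> C\<^sup>2"
  shows "norm \<xi> \<le> C"
proof -
  have "(norm \<xi>)\<^sup>2 \<le> C\<^sup>2"
    unfolding norm_ell2_sq by (rule infsum_le_finite_sums) (auto intro: ell2_summable assms)
  then show ?thesis using assms(1) by (simp add: power2_le_iff_abs_le)
qed

lemma ell2_of_bounded_sums:
  assumes "\<And>F. finite F \<Longrightarrow> (\<Sum>i\<in>F. (cmod (v i))\<^sup>2) \<le> C"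
  obtains \<xi> where "\<And>i. ell2_apply \<xi> i = v i"
proof
  have "(\<lambda>i. (cmod (v i))\<^sup>2) summable_on UNIV"
    by (rule nonneg_bdd_above_summable_on) (auto simp: bdd_above_def intro!: exI[of _ C] assms)
  then show "ell2_apply (Abs_ell2 v) i = v i" for i by (simp add: Abs_ell2_inverse)
qed

text \<open>
  Completeness of the Hilbert space passes to the operators on it.  It is what makes the adjoints of
  a convergent sequence of operators converge.
\<close>
instance ell2 :: (type) banach
proof
  fix X :: "nat \<Rightarrow> 'a ell2" assume X: "Cauchy X"
  have "Cauchy (\<lambda>n. ell2_apply (X n) i)" for i
  proof (rule metric_CauchyI)
    fix e :: real assume "e > 0"
    then obtain M where M: "\<And>m n. m \<ge> M \<Longrightarrow> n \<ge> M \<Longrightarrow> dist (X m) (X n) < e"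
      using X by (meson metric_CauchyD)
    have "dist (ell2_apply (X m) i) (ell2_apply (X n) i) \<le> dist (X m) (X n)" for m n
      using cmod_ell2_apply_le[of "X m - X n" i] by (simp add: dist_norm minus_ell2.rep_eq)
    then show "\<exists>M. \<forall>m\<ge>M. \<forall>n\<ge>M. dist (ell2_apply (X m) i) (ell2_apply (X n) i) < e"
      using M by (meson le_less_trans)
  qed
  then have "\<exists>l. (\<lambda>n. ell2_apply (X n) i) \<longlonglongrightarrow> l" for i
    using Cauchy_convergent convergent_def by blast
  then obtain L where L: "\<And>i. (\<lambda>n. ell2_apply (X n) i) \<longlonglongrightarrow> L i" by metis
  \<comment> \<open>The pointwise limit is reached in norm because the Cauchy estimate holds on each finite set of
    indices, uniformly, and survives the limit there.\<close>
  have tail: "\<exists>M. \<forall>n\<ge>M. \<forall>F. finite F \<longrightarrow> (\<Sum>i\<in>F. (cmod (ell2_apply (X n) i - L i))\<^sup>2) \<le> e\<^sup>2"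
    if "e > 0" for e
  proof -
    obtain M where M: "\<And>m n. m \<ge> M \<Longrightarrow> n \<ge> M \<Longrightarrow> dist (X m) (X n) < e"
      using X \<open>e > 0\<close> by (meson metric_CauchyD)
    have "(\<Sum>i\<in>F. (cmod (ell2_apply (X n) i - L i))\<^sup>2) \<le> e\<^sup>2" if "n \<ge> M" "finite F" for n F
    proof (rule Lim_bounded)
      show "(\<lambda>m. \<Sum>i\<in>F. (cmod (ell2_apply (X n) i - ell2_apply (X m) i))\<^sup>2)
          \<longlonglongrightarrow> (\<Sum>i\<in>F. (cmod (ell2_apply (X n) i - L i))\<^sup>2)"
        by (intro tendsto_intros L)
      have "(norm (X n - X m))\<^sup>2 \<le> e\<^sup>2" if "m \<ge> M" for m
        using M[OF \<open>n \<ge> M\<close> that] by (intro power_mono) (auto simp: dist_norm)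
      then show "\<forall>m\<ge>M. (\<Sum>i\<in>F. (cmod (ell2_apply (X n) i - ell2_apply (X m) i))\<^sup>2) \<le> e\<^sup>2"
        using sum_le_norm_ell2_sq[OF \<open>finite F\<close>, of "X n - X m" for m]
        by (auto simp: minus_ell2.rep_eq intro: order_trans)
    qed
    then show ?thesis by blast
  qed
  obtain M where "\<And>F. finite F \<Longrightarrow> (\<Sum>i\<in>F. (cmod (ell2_apply (X M) i - L i))\<^sup>2) \<le> 1\<^sup>2"
    using tail[of 1] by auto
  then obtain \<zeta> where \<zeta>: "\<And>i. ell2_apply \<zeta> i = ell2_apply (X M) i - L i"
    using ell2_of_bounded_sums[of "\<lambda>i. ell2_apply (X M) i - L i" "1\<^sup>2"] by blast
  have lim: "ell2_apply (X M - \<zeta>) i = L i" for i by (simp add: minus_ell2.rep_eq \<zeta>)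
  have "X \<longlonglongrightarrow> X M - \<zeta>"
  proof (rule metric_LIMSEQ_I)
    fix r :: real assume "r > 0"
    then obtain N where N: "\<And>n F. n \<ge> N \<Longrightarrow> finite F \<Longrightarrow>
        (\<Sum>i\<in>F. (cmod (ell2_apply (X n) i - L i))\<^sup>2) \<le> (r/2)\<^sup>2"
      using tail[of "r/2"] by auto
    have "dist (X n) (X M - \<zeta>) \<le> r/2" if "n \<ge> N" for n
      unfolding dist_norm by (rule norm_ell2_leI) (use \<open>r > 0\<close> N[OF that] lim in \<open>simp_all add: minus_ell2.rep_eq \<zeta>\<close>)
    then show "\<exists>N. \<forall>n\<ge>N. dist (X n) (X M - \<zeta>) < r"
      using \<open>r > 0\<close> by (intro exI[of _ N]) (auto intro: le_less_trans[of _ "r/2"])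
  qed
  then show "convergent X" by (rule convergentI)
qed

text \<open>The set \<open>F\<close> is meant to be finite; otherwise the entries need not be square summable.\<close>

definition fin_vec :: "('i \<Rightarrow> complex) \<Rightarrow> 'i set \<Rightarrow> 'i ell2" where
  "fin_vec v F = Abs_ell2 (\<lambda>i. if i \<in> F then v i else 0)"

lemma fin_vec_apply:
  assumes "finite F"
  shows "ell2_apply (fin_vec v F) i = (if i \<in> F then v i else 0)"
proof -
  have "(\<lambda>i. (cmod (v i))\<^sup>2) summable_on F" using assms by simp
  then have "(\<lambda>i. (cmod (if i \<in> F then v i else 0))\<^sup>2) summable_on UNIV"
    by (rule summable_on_cong_neutral[THEN iffD1, rotated 3]) auto
  then show ?thesis by (simp add: fin_vec_def Abs_ell2_inverse)
qed

lemma norm_fin_vec_sq: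
  assumes "finite F"
  shows "(norm (fin_vec v F))\<^sup>2 = (\<Sum>i\<in>F. (cmod (v i))\<^sup>2)"
proof -
  have "(norm (fin_vec v F))\<^sup>2 = (\<Sum>\<^sub>\<infinity>i\<in>F. (cmod (v i))\<^sup>2)"
    unfolding norm_ell2_sq by (rule infsum_cong_neutral) (auto simp: fin_vec_apply assms)
  then show ?thesis using assms by simp
qed

lemma norm_fin_vec_single: "norm (fin_vec (\<lambda>_. 1) {i}) = 1"
  using norm_fin_vec_sq[of "{i}" "\<lambda>_. 1"] by (simp add: power2_eq_1_iff) (smt (verit) norm_ge_zero)

lemma ell2_apply_sum: "ell2_apply (\<Sum>k\<in>A. \<xi> k) i = (\<Sum>k\<in>A. ell2_apply (\<xi> k) i)"
  by (induction A rule: infinite_finite_induct) (auto simp: zero_ell2.rep_eq plus_ell2.rep_eq)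


section \<open>Operators and their adjoints\<close>

interpretation compose: bounded_bilinear "(o\<^sub>L)"
  by (rule bounded_bilinear_blinfun_compose)

lemma norm_op_leI:
  assumes "0 \<le> K"
    and "\<And>\<xi> A. finite A \<Longrightarrow> (\<Sum>i\<in>A. (cmod (ell2_apply (blinfun_apply T \<xi>) i))\<^sup>2) \<le> K\<^sup>2 * (norm \<xi>)\<^sup>2"
  shows "norm (T :: 'i op) \<le> K"
proof (rule norm_blinfun_bound[OF assms(1)])
  fix \<xi> show "norm (blinfun_apply T \<xi>) \<le> K * norm \<xi>"
    by (rule norm_ell2_leI) (use assms in \<open>auto simp: power_mult_distrib\<close>)
qed

lemma op_scaleC_of_real: "op_scaleC (of_real r) T = r *\<^sub>R T"
  by (intro blinfun_eqI ell2_eqI) (simp add: op_scaleC_apply blinfun.scaleR_left scaleR_ell2.rep_eq)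

lemma bounded_linear_op_scaleC: "bounded_linear (op_scaleC c)"
  unfolding op_scaleC_def by (rule compose.bounded_linear_right)

lemma norm_op_scaleC_i_le: "norm (op_scaleC \<i> T) \<le> norm T"
proof (rule norm_blinfun_bound)
  fix \<xi>
  have "norm (blinfun_apply (op_scaleC \<i> T) \<xi>) = norm (blinfun_apply T \<xi>)"
    by (simp add: norm_ell2_eq op_scaleC_apply norm_mult)
  then show "norm (blinfun_apply (op_scaleC \<i> T) \<xi>) \<le> norm T * norm \<xi>"
    by (simp add: norm_blinfun)
qed simp

lemma op_subspace_closure:
  assumes "op_subspace A"
  shows "op_subspace (closure A)"
  unfolding op.subspace_def
proof (intro conjI ballI allI)
  show "0 \<in> closure A" using assms closure_subset by (auto simp: op.subspace_def)
next
  fix S T assume "S \<in> closure A" "T \<in> closure A"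
  then obtain s t where "\<And>n. s n \<in> A" "s \<longlonglongrightarrow> S" "\<And>n. t n \<in> A" "t \<longlonglongrightarrow> T"
    by (metis closure_sequential)
  then show "S + T \<in> closure A"
    unfolding closure_sequential using assms
    by (intro exI[of _ "\<lambda>n. s n + t n"]) (auto intro: tendsto_add simp: op.subspace_def)
next
  fix c T assume "T \<in> closure A"
  then obtain t where "\<And>n. t n \<in> A" "t \<longlonglongrightarrow> T" by (metis closure_sequential)
  then show "op_scaleC c T \<in> closure A"
    unfolding closure_sequential using assms
    by (intro exI[of _ "\<lambda>n. op_scaleC c (t n)"])
      (auto intro: bounded_linear.tendsto[OF bounded_linear_op_scaleC] simp: op.subspace_def)
qed

text \<open>
  Multiplying the first argument by \<open>\<i>\<close> turns the imaginary part into a real part.  Additivity and continuity of the complex inner product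
  follow from the real one.
\<close>
lemma cinner_eq_inner:
  "cinner_ell2 \<xi> \<eta> = Complex (inner \<xi> \<eta>) (inner (blinfun_apply (op_scaleC \<i> id_blinfun) \<xi>) \<eta>)"
proof (rule complex_eqI)
  have "inner (blinfun_apply (op_scaleC \<i> id_blinfun) \<xi>) \<eta>
      = Re (\<Sum>\<^sub>\<infinity>i. - \<i> * (cnj (ell2_apply \<xi> i) * ell2_apply \<eta> i))"
    by (simp add: inner_ell2_def cinner_ell2.rep_eq op_scaleC_apply mult.assoc)
  also have "\<dots> = Im (cinner_ell2 \<xi> \<eta>)"
    by (subst infsum_cmult_right') (simp add: cinner_ell2.rep_eq)
  finally show "Im (cinner_ell2 \<xi> \<eta>) = Im (Complex (inner \<xi> \<eta>)
      (inner (blinfun_apply (op_scaleC \<i> id_blinfun) \<xi>) \<eta>))" by simp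
qed (simp add: inner_ell2_def)

lemma is_adjoint_inner: "is_adjoint T S \<Longrightarrow> inner \<xi> (blinfun_apply T \<eta>) = inner (blinfun_apply S \<xi>) \<eta>"
  by (simp add: is_adjoint_def inner_ell2_def)

lemma is_adjoint_unique:
  assumes "is_adjoint T S" "is_adjoint T S'"
  shows "S = S'"
proof (rule blinfun_eqI)
  fix \<xi>
  have "inner (blinfun_apply S \<xi> - blinfun_apply S' \<xi>) \<eta> = 0" for \<eta>
    using is_adjoint_inner[OF assms(1), of \<xi> \<eta>] is_adjoint_inner[OF assms(2), of \<xi> \<eta>]
    by (simp add: inner_diff_left)
  then show "blinfun_apply S \<xi> = blinfun_apply S' \<xi>"
    by (metis inner_eq_zero_iff right_minus_eq)
qed

lemma norm_adjoint_le:
  assumes "is_adjoint T S"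
  shows "norm S \<le> norm T"
proof (rule norm_blinfun_bound)
  fix \<xi>
  let ?\<zeta> = "blinfun_apply S \<xi>"
  have "(norm ?\<zeta>)\<^sup>2 = inner \<xi> (blinfun_apply T ?\<zeta>)"
    by (simp add: is_adjoint_inner[OF assms] power2_norm_eq_inner)
  also have "\<dots> \<le> norm \<xi> * norm (blinfun_apply T ?\<zeta>)" by (rule norm_cauchy_schwarz)
  also have "\<dots> \<le> norm \<xi> * (norm T * norm ?\<zeta>)" by (intro mult_left_mono norm_blinfun) auto
  finally have "norm ?\<zeta> * norm ?\<zeta> \<le> (norm T * norm \<xi>) * norm ?\<zeta>"
    by (simp add: power2_eq_square mult_ac)
  then show "norm ?\<zeta> \<le> norm T * norm \<xi>"
    by (cases "norm ?\<zeta> = 0") (auto simp: mult_le_cancel_right zero_le_mult_iff)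
qed simp

lemma cinner_add:
  "cinner_ell2 (\<xi> + \<xi>') \<eta> = cinner_ell2 \<xi> \<eta> + cinner_ell2 \<xi>' \<eta>"
  "cinner_ell2 \<eta> (\<xi> + \<xi>') = cinner_ell2 \<eta> \<xi> + cinner_ell2 \<eta> \<xi>'"
  by (simp_all add: cinner_eq_inner blinfun.add_right inner_add_left inner_add_right complex_eq_iff)

lemma cinner_diff:
  "cinner_ell2 (\<xi> - \<xi>') \<eta> = cinner_ell2 \<xi> \<eta> - cinner_ell2 \<xi>' \<eta>"
  "cinner_ell2 \<eta> (\<xi> - \<xi>') = cinner_ell2 \<eta> \<xi> - cinner_ell2 \<eta> \<xi>'"
  by (simp_all add: cinner_eq_inner blinfun.diff_right inner_diff_left inner_diff_right complex_eq_iff)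

lemma is_adjoint_add: "is_adjoint T S \<Longrightarrow> is_adjoint T' S' \<Longrightarrow> is_adjoint (T + T') (S + S')"
  by (simp add: is_adjoint_def blinfun.add_left cinner_add)

lemma is_adjoint_diff: "is_adjoint T S \<Longrightarrow> is_adjoint T' S' \<Longrightarrow> is_adjoint (T - T') (S - S')"
  by (simp add: is_adjoint_def blinfun.diff_left cinner_diff)

lemma is_adjoint_scaleC: "is_adjoint T S \<Longrightarrow> is_adjoint (op_scaleC c T) (op_scaleC (cnj c) S)"
  unfolding is_adjoint_def cinner_ell2.rep_eq op_scaleC_apply
  by (simp add: mult.left_commute[of _ c] mult.assoc infsum_cmult_right')

lemma is_adjoint_limit:
  assumes "\<And>n. is_adjoint (t n) (s n)" "t \<longlonglongrightarrow> T" "s \<longlonglongrightarrow> S"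
  shows "is_adjoint T S"
proof -
  let ?J = "blinfun_apply (op_scaleC \<i> id_blinfun)"
  have eq: "inner \<xi> (blinfun_apply (t n) \<eta>) = inner (blinfun_apply (s n) \<xi>) \<eta>"
      "inner (?J \<xi>) (blinfun_apply (t n) \<eta>) = inner (?J (blinfun_apply (s n) \<xi>)) \<eta>" for n \<xi> \<eta>
    using assms(1)[of n] unfolding is_adjoint_def cinner_eq_inner complex.inject by blast+
  have "inner \<xi> (blinfun_apply T \<eta>) = inner (blinfun_apply S \<xi>) \<eta>" for \<xi> \<eta>
    by (rule LIMSEQ_unique[of "\<lambda>n. inner \<xi> (blinfun_apply (t n) \<eta>)"])
      (intro tendsto_intros assms, unfold eq(1), intro tendsto_intros assms)
  moreover have "inner (?J \<xi>) (blinfun_apply T \<eta>) = inner (?J (blinfun_apply S \<xi>)) \<eta>" for \<xi> \<eta>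
    by (rule LIMSEQ_unique[of "\<lambda>n. inner (?J \<xi>) (blinfun_apply (t n) \<eta>)"])
      (intro tendsto_intros assms, unfold eq(2), intro tendsto_intros assms)
  ultimately show ?thesis unfolding is_adjoint_def cinner_eq_inner complex.inject by blast
qed

text \<open>
  Taking adjoints is norm decreasing, so the adjoints of a sequence converging to \<open>T\<close> form a Cauchy
  sequence, whose limit is adjoint to \<open>T\<close>.
\<close>
lemma adjoint_in_closure:
  fixes A :: "'i op set"
  assumes "\<And>T. T \<in> A \<Longrightarrow> \<exists>S\<in>A. is_adjoint T S" and "T \<in> closure A"
  shows "\<exists>S\<in>closure A. is_adjoint T S"
proof -
  obtain t where t: "\<And>n. t n \<in> A" "t \<longlonglongrightarrow> T" using assms(2) by (metis closure_sequential)
  have "\<forall>n. \<exists>S. S \<in> A \<and> is_adjoint (t n) S" using t(1) assms(1) by blast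
  then obtain s where s: "\<And>n. s n \<in> A" "\<And>n. is_adjoint (t n) (s n)" by metis
  have "Cauchy s"
  proof (rule metric_CauchyI)
    fix e :: real assume "e > 0"
    then obtain M where M: "\<And>m n. m \<ge> M \<Longrightarrow> n \<ge> M \<Longrightarrow> dist (t m) (t n) < e"
      using LIMSEQ_imp_Cauchy[OF t(2)] by (meson metric_CauchyD)
    have "dist (s m) (s n) \<le> dist (t m) (t n)" for m n
      unfolding dist_norm by (intro norm_adjoint_le is_adjoint_diff s)
    then show "\<exists>M. \<forall>m\<ge>M. \<forall>n\<ge>M. dist (s m) (s n) < e"
      using M by (meson le_less_trans)
  qed
  then obtain S where S: "s \<longlonglongrightarrow> S" using Cauchy_convergent convergent_def by blast
  then have "S \<in> closure A" using s closure_sequential by blast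
  moreover have "is_adjoint T S" by (rule is_adjoint_limit[OF s(2) t(2) S])
  ultimately show ?thesis by blast
qed

lemma cstar_subalgebra_closure_span:
  fixes G :: "'i op set"
  assumes prod: "\<And>S T. S \<in> G \<Longrightarrow> T \<in> G \<Longrightarrow> S o\<^sub>L T \<in> G"
    and adj: "\<And>T. T \<in> G \<Longrightarrow> \<exists>S\<in>G. is_adjoint T S"
  shows "cstar_subalgebra (closure (op_span G))"
proof -
  have scale_l: "op_scaleC c S o\<^sub>L T = op_scaleC c (S o\<^sub>L T)" for c and S T :: "'i op"
    by (intro blinfun_eqI ell2_eqI) (simp add: op_scaleC_apply)
  \<comment> \<open>The ambient operators are only real linear, so a scalar can be pulled out of the right factor
    only because the left factor has an adjoint.\<close>
  have scale_r: "S o\<^sub>L op_scaleC c T = op_scaleC c (S o\<^sub>L T)"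
    if "is_adjoint S S'" for c and S S' T :: "'i op"
  proof (rule blinfun_eqI)
    fix \<xi>
    let ?l = "blinfun_apply (S o\<^sub>L op_scaleC c T) \<xi>" and ?r = "blinfun_apply (op_scaleC c (S o\<^sub>L T)) \<xi>"
    have cinner_scale: "cinner_ell2 \<zeta> (blinfun_apply (op_scaleC c R) \<xi>) = c * cinner_ell2 \<zeta> (blinfun_apply R \<xi>)"
      for \<zeta> and R :: "'i op"
      unfolding cinner_ell2.rep_eq op_scaleC_apply
      by (simp add: mult.left_commute[of _ c] infsum_cmult_right')
    have "cinner_ell2 \<zeta> ?l = cinner_ell2 \<zeta> ?r" for \<zeta>
      using that by (simp add: is_adjoint_def cinner_scale)
    then have "inner (?l - ?r) (?l - ?r) = 0"
      by (simp only: inner_ell2_def cinner_diff) simp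
    then show "?l = ?r" by (simp only: inner_eq_zero_iff right_minus_eq)
  qed
  have prod1: "S o\<^sub>L T \<in> op_span G" if "S \<in> G" "T \<in> op_span G" for S T
    using that(2)
  proof (induction rule: op.span_induct_alt)
    case (step c x y)
    obtain S' where "is_adjoint S S'" using adj[OF \<open>S \<in> G\<close>] by blast
    then show ?case
      using step by (simp add: compose.add_right scale_r)
        (auto intro!: op.span_add op.span_scale intro: op.span_base prod \<open>S \<in> G\<close>)
  qed (simp add: compose.zero_right op.span_zero)
  have prod2: "S o\<^sub>L T \<in> op_span G" if "S \<in> op_span G" "T \<in> op_span G" for S T
    using that(1)
  proof (induction rule: op.span_induct_alt)
    case (step c x y)
    then show ?case
      by (simp add: compose.add_left scale_l) (auto intro!: op.span_add op.span_scale prod1 \<open>T \<in> op_span G\<close>)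
  qed (simp add: compose.zero_left op.span_zero)
  have prod3: "S o\<^sub>L T \<in> closure (op_span G)" if ST: "S \<in> closure (op_span G)" "T \<in> closure (op_span G)" for S T
  proof -
    obtain s t where "\<And>n. s n \<in> op_span G" "s \<longlonglongrightarrow> S" "\<And>n. t n \<in> op_span G" "t \<longlonglongrightarrow> T"
      using ST by (metis closure_sequential)
    then show ?thesis
      unfolding closure_sequential
      by (intro exI[of _ "\<lambda>n. s n o\<^sub>L t n"]) (auto intro: compose.tendsto prod2)
  qed
  have adj1: "\<exists>S\<in>op_span G. is_adjoint T S" if "T \<in> op_span G" for T
    using that
  proof (induction rule: op.span_induct_alt)
    case base
    have "is_adjoint 0 0" by (simp add: is_adjoint_def cinner_ell2.rep_eq zero_ell2.rep_eq)
    then show ?case using op.span_zero by blast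
  next
    case (step c x y)
    then show ?case
      using adj[of x] by (meson is_adjoint_add is_adjoint_scaleC op.span_add op.span_scale op.span_base)
  qed
  show ?thesis
    unfolding cstar_subalgebra_def
    using prod3 adjoint_in_closure[OF adj1] op_subspace_closure[OF op.subspace_span[of G]] by blast
qed


section \<open>Separating a point from a closed subspace\<close>

text \<open>
  A linear functional that is small on a subspace and nonzero off it is found below the distance
  function to that subspace: a minimal sublinear functional is linear, and minimal ones exist below any
  sublinear functional by Zorn's lemma.
\<close>
definition sublinear :: "('a::real_vector \<Rightarrow> real) \<Rightarrow> bool" where
  "sublinear q \<longleftrightarrow> (\<forall>x y. q (x + y) \<le> q x + q y) \<and> (\<forall>r>0. \<forall>x. q (r *\<^sub>R x) \<le> r * q x)"

lemma sublinear_zero: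
  assumes "sublinear q"
  shows "q 0 = 0"
proof -
  have "q (2 *\<^sub>R 0) \<le> 2 * q 0" "q ((1/2) *\<^sub>R 0) \<le> (1/2) * q 0"
    using assms unfolding sublinear_def by (blast intro: zero_less_numeral half_gt_zero zero_less_one)+
  then show ?thesis by simp
qed

lemma sublinear_ge:
  assumes "sublinear q"
  shows "- q (- x) \<le> q x"
proof -
  have "q (x + - x) \<le> q x + q (- x)" using assms unfolding sublinear_def by blast
  then show ?thesis using sublinear_zero[OF assms] by simp
qed

lemma sublinear_scale:
  assumes "sublinear q" "r > 0"
  shows "q (r *\<^sub>R x) = r * q x"
proof (rule antisym)
  show "q (r *\<^sub>R x) \<le> r * q x" using assms by (simp add: sublinear_def)
  have "q (inverse r *\<^sub>R (r *\<^sub>R x)) \<le> inverse r * q (r *\<^sub>R x)"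
    using assms by (simp add: sublinear_def del: scaleR_scaleR)
  then show "r * q x \<le> q (r *\<^sub>R x)" using assms(2) by (simp add: field_simps)
qed

text \<open>
  The tilted functional is the infimum over \<open>t \<ge> 0\<close> of \<open>q (x + t y) - t q y\<close>.  It has two uses: when \<open>q\<close>
  is minimal it must equal \<open>q\<close>, which makes \<open>q\<close> odd; and when \<open>q\<close> is a distance function, every linear
  functional below the tilt has the value of \<open>q\<close> at \<open>y\<close> or more.
\<close>
lemma sublinear_tilt:
  assumes q: "sublinear q"
  obtains q' where "sublinear q'" "\<And>x. q' x \<le> q x" "q' (- y) \<le> - q y"
proof
  define q' where "q' x = (INF t\<in>{0::real..}. q (x + t *\<^sub>R y) - t * q y)" for x
  have ty: "q (t *\<^sub>R y) = t * q y" if "t \<ge> 0" for t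
    using sublinear_scale[OF q, of t y] sublinear_zero[OF q] that by (cases "t = 0") auto
  have bdd: "bdd_below ((\<lambda>t. q (x + t *\<^sub>R y) - t * q y) ` {0..})" for x
  proof (rule bdd_belowI2)
    fix t :: real assume "t \<in> {0..}"
    moreover have "q ((x + t *\<^sub>R y) + - x) \<le> q (x + t *\<^sub>R y) + q (- x)"
      using q unfolding sublinear_def by blast
    ultimately show "- q (- x) \<le> q (x + t *\<^sub>R y) - t * q y" using ty[of t] by simp
  qed
  have le: "q' x \<le> q (x + t *\<^sub>R y) - t * q y" if "t \<ge> 0" for x t
    unfolding q'_def by (rule cINF_lower[OF bdd]) (use that in auto)
  have ge: "m \<le> q' x" if "\<And>t. t \<ge> 0 \<Longrightarrow> m \<le> q (x + t *\<^sub>R y) - t * q y" for m x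
    unfolding q'_def by (rule cINF_greatest) (use that in auto)
  show "q' x \<le> q x" for x using le[of 0 x] by simp
  show "q' (- y) \<le> - q y" using le[of 1 "- y"] sublinear_zero[OF q] by simp
  show "sublinear q'"
    unfolding sublinear_def
  proof (intro conjI allI impI)
    fix x z
    have "q' (x + z) - (q (z + t *\<^sub>R y) - t * q y) \<le> q' x" if "t \<ge> 0" for t
    proof (rule ge)
      fix s :: real assume "s \<ge> 0"
      have "q' (x + z) \<le> q ((x + z) + (s + t) *\<^sub>R y) - (s + t) * q y"
        using \<open>s \<ge> 0\<close> that by (intro le) auto
      also have "q ((x + z) + (s + t) *\<^sub>R y) = q ((x + s *\<^sub>R y) + (z + t *\<^sub>R y))"
        by (simp add: algebra_simps)
      also have "\<dots> \<le> q (x + s *\<^sub>R y) + q (z + t *\<^sub>R y)"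
        using q unfolding sublinear_def by blast
      finally show "q' (x + z) - (q (z + t *\<^sub>R y) - t * q y) \<le> q (x + s *\<^sub>R y) - s * q y"
        by (simp add: algebra_simps)
    qed
    then have "q' (x + z) - q' x \<le> q (z + t *\<^sub>R y) - t * q y" if "t \<ge> 0" for t
      using that by (smt (verit))
    then have "q' (x + z) - q' x \<le> q' z" by (rule ge)
    then show "q' (x + z) \<le> q' x + q' z" by simp
  next
    fix r :: real and x assume "r > 0"
    have "q' (r *\<^sub>R x) / r \<le> q' x"
    proof (rule ge)
      fix t :: real assume "t \<ge> 0"
      have "q' (r *\<^sub>R x) \<le> q (r *\<^sub>R x + (r * t) *\<^sub>R y) - (r * t) * q y"
        using \<open>r > 0\<close> \<open>t \<ge> 0\<close> by (intro le) auto
      also have "q (r *\<^sub>R x + (r * t) *\<^sub>R y) = r * q (x + t *\<^sub>R y)"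
        using sublinear_scale[OF q \<open>r > 0\<close>, of "x + t *\<^sub>R y"] by (simp add: scaleR_add_right)
      finally show "q' (r *\<^sub>R x) / r \<le> q (x + t *\<^sub>R y) - t * q y"
        using \<open>r > 0\<close> by (simp add: field_simps)
    qed
    then show "q' (r *\<^sub>R x) \<le> r * q' x" using \<open>r > 0\<close> by (simp add: field_simps)
  qed
qed

text \<open>
  Pointwise infima of sublinear functionals need not be subadditive; along a chain they are, because
  any two members can be replaced by the smaller one.
\<close>
lemma sublinear_chain_lower_bound:
  fixes p :: "'a::real_vector \<Rightarrow> real"
  assumes C: "C \<noteq> {}" "\<And>q. q \<in> C \<Longrightarrow> sublinear q" "\<And>q x. q \<in> C \<Longrightarrow> q x \<le> p x"
    and chain: "\<And>q r. q \<in> C \<Longrightarrow> r \<in> C \<Longrightarrow> (\<forall>x. r x \<le> q x) \<or> (\<forall>x. q x \<le> r x)"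
  shows "sublinear (\<lambda>x. INF q\<in>C. q x)" "\<And>q x. q \<in> C \<Longrightarrow> (INF q\<in>C. q x) \<le> q x"
proof -
  have bdd: "bdd_below ((\<lambda>q. q x) ` C)" for x
  proof (rule bdd_belowI2)
    fix q assume "q \<in> C"
    then show "- p (- x) \<le> q x"
      using sublinear_ge[of q x] C(2,3) by (metis neg_le_iff_le order_trans)
  qed
  show le: "(INF q\<in>C. q x) \<le> q x" if "q \<in> C" for q x
    by (rule cINF_lower[OF bdd that])
  show "sublinear (\<lambda>x. INF q\<in>C. q x)"
    unfolding sublinear_def
  proof (intro conjI allI impI)
    fix x y
    have "(INF q\<in>C. q (x + y)) \<le> q x + r y" if "q \<in> C" "r \<in> C" for q r
    proof -
      obtain s where s: "s \<in> C" "s x \<le> q x" "s y \<le> r y"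
        using chain[OF \<open>q \<in> C\<close> \<open>r \<in> C\<close>] \<open>q \<in> C\<close> \<open>r \<in> C\<close> by blast
      have "(INF q\<in>C. q (x + y)) \<le> s (x + y)" by (rule le[OF s(1)])
      also have "\<dots> \<le> s x + s y" using C(2)[OF s(1)] by (simp add: sublinear_def)
      finally show ?thesis using s by simp
    qed
    then have "(INF q\<in>C. q (x + y)) - r y \<le> (INF q\<in>C. q x)" if "r \<in> C" for r
      by (intro cINF_greatest[OF C(1)]) (use that in \<open>simp add: diff_le_eq\<close>)
    then have "(INF q\<in>C. q (x + y)) - (INF q\<in>C. q x) \<le> (INF q\<in>C. q y)"
      by (intro cINF_greatest[OF C(1)]) (simp add: diff_le_eq add.commute)
    then show "(INF q\<in>C. q (x + y)) \<le> (INF q\<in>C. q x) + (INF q\<in>C. q y)" by simp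
  next
    fix r :: real and x assume "r > 0"
    have "(INF q\<in>C. q (r *\<^sub>R x)) / r \<le> (INF q\<in>C. q x)"
    proof (rule cINF_greatest[OF C(1)])
      fix q assume "q \<in> C"
      then have "(INF q\<in>C. q (r *\<^sub>R x)) \<le> r * q x"
        using le[of q "r *\<^sub>R x"] C(2)[of q] \<open>r > 0\<close> by (simp add: sublinear_scale)
      then show "(INF q\<in>C. q (r *\<^sub>R x)) / r \<le> q x" using \<open>r > 0\<close> by (simp add: field_simps)
    qed
    then show "(INF q\<in>C. q (r *\<^sub>R x)) \<le> r * (INF q\<in>C. q x)"
      using \<open>r > 0\<close> by (simp add: field_simps)
  qed
qed

lemma linear_below_sublinear:
  fixes p :: "'a::real_vector \<Rightarrow> real"
  assumes p: "sublinear p"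
  obtains q where "linear q" "\<And>x. q x \<le> p x"
proof -
  define A where "A = {q. sublinear q \<and> (\<forall>x. q x \<le> p x)}"
  define P where "P q r \<longleftrightarrow> (\<forall>x. r x \<le> q x)" for q r :: "'a \<Rightarrow> real"
  have "\<exists>m\<in>A. \<forall>q\<in>A. P m q \<longrightarrow> q = m"
  proof (rule predicate_Zorn)
    show "partial_order_on A (relation_of P A)"
      by (rule partial_order_on_relation_ofI) (auto simp: P_def fun_eq_iff intro: order_trans antisym)
    fix C assume C: "C \<in> Chains (relation_of P A)"
    show "\<exists>u\<in>A. \<forall>q\<in>C. P q u"
    proof (cases "C = {}")
      case True
      then show ?thesis using p by (auto simp: A_def)
    next
      case False
      have sub: "q \<in> A" if "q \<in> C" for q
        using C that by (auto simp: Chains_def relation_of_def)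
      have chain: "(\<forall>x. r x \<le> q x) \<or> (\<forall>x. q x \<le> r x)" if "q \<in> C" "r \<in> C" for q r
        using C that by (auto simp: Chains_def relation_of_def P_def)
      let ?u = "\<lambda>x. INF q\<in>C. q x"
      have sub': "sublinear q" "q x \<le> p x" if "q \<in> C" for q x
        using sub[OF that] by (auto simp: A_def)
      have u1: "sublinear ?u"
        by (rule sublinear_chain_lower_bound(1)[where p=p], (fact False sub' chain)+)
      have u2: "?u x \<le> q x" if "q \<in> C" for q x
        by (rule sublinear_chain_lower_bound(2)[where p=p], (fact False sub' chain that)+)
      obtain q where "q \<in> C" using False by blast
      then have "?u x \<le> p x" for x
        using u2[OF \<open>q \<in> C\<close>, of x] sub'(2)[OF \<open>q \<in> C\<close>, of x] by linarith
      then have "?u \<in> A" using u1 by (simp add: A_def)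
      moreover have "\<forall>q\<in>C. P q ?u" using u2 by (simp add: P_def)
      ultimately show ?thesis by blast
    qed
  qed
  then obtain m where "m \<in> A" and minimal: "\<And>q. q \<in> A \<Longrightarrow> P m q \<Longrightarrow> q = m" by blast
  then have m: "sublinear m" "m x \<le> p x" for x by (simp_all add: A_def)
  have min: "q = m" if "sublinear q" "\<And>x. q x \<le> m x" for q
    using minimal[of q] that order_trans[OF that(2) m(2)] by (simp add: A_def P_def)
  have neg: "m (- y) = - m y" for y
  proof -
    obtain q' where "sublinear q'" "\<And>x. q' x \<le> m x" "q' (- y) \<le> - m y"
      using sublinear_tilt[OF m(1)] by blast
    then have "m (- y) \<le> - m y" using min by blast
    then show ?thesis using sublinear_ge[OF m(1), of y] by linarith
  qed
  have add: "m (x + y) = m x + m y" for x y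
  proof (rule antisym)
    show "m (x + y) \<le> m x + m y" using m(1) by (simp add: sublinear_def)
    have "m ((x + y) + - y) \<le> m (x + y) + m (- y)" using m(1) unfolding sublinear_def by blast
    then show "m x + m y \<le> m (x + y)" by (simp add: neg)
  qed
  have "m (r *\<^sub>R x) = r * m x" for r x
  proof (cases r "0::real" rule: linorder_cases)
    case less
    then show ?thesis
      using sublinear_scale[OF m(1), of "- r" x] neg[of "r *\<^sub>R x"] by simp
  qed (use sublinear_scale[OF m(1)] sublinear_zero[OF m(1)] in auto)
  then have "linear m" by (intro linearI) (simp_all add: add)
  then show thesis using that m(2) by blast
qed

lemma sublinear_infdist:
  fixes A :: "'a::real_normed_vector set"
  assumes A: "subspace A"
  shows "sublinear (\<lambda>x. infdist x A)"
  unfolding sublinear_def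
proof (intro conjI allI impI)
  have ne: "A \<noteq> {}" using subspace_0[OF A] by blast
  have ge: "m \<le> infdist x A" if "\<And>a. a \<in> A \<Longrightarrow> m \<le> dist x a" for m x
    unfolding infdist_notempty[OF ne] by (rule cINF_greatest[OF ne that])
  {
    fix x y
    have "infdist (x + y) A \<le> dist x a + dist y b" if "a \<in> A" "b \<in> A" for a b
    proof -
      have "infdist (x + y) A \<le> dist (x + y) (a + b)"
        by (rule infdist_le) (rule subspace_add[OF A that])
      also have "\<dots> \<le> dist x a + dist y b" by (rule dist_triangle_add)
      finally show ?thesis .
    qed
    then have "infdist (x + y) A - dist y b \<le> infdist x A" if "b \<in> A" for b
      using that by (intro ge) (simp add: diff_le_eq)
    then have "infdist (x + y) A - infdist x A \<le> infdist y A"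
      by (intro ge) (simp add: diff_le_eq add.commute)
    then show "infdist (x + y) A \<le> infdist x A + infdist y A" by simp
  next
    fix r :: real and x assume "r > 0"
    have "infdist (r *\<^sub>R x) A / r \<le> infdist x A"
    proof (rule ge)
      fix a assume "a \<in> A"
      have "infdist (r *\<^sub>R x) A \<le> dist (r *\<^sub>R x) (r *\<^sub>R a)"
        by (rule infdist_le) (rule subspace_scale[OF A \<open>a \<in> A\<close>])
      also have "\<dots> = r * dist x a"
        using \<open>r > 0\<close> by (metis abs_of_pos dist_norm norm_scaleR scaleR_diff_right)
      finally show "infdist (r *\<^sub>R x) A / r \<le> dist x a"
        using \<open>r > 0\<close> by (simp add: field_simps)
    qed
    then show "infdist (r *\<^sub>R x) A \<le> r * infdist x A" using \<open>r > 0\<close> by (simp add: field_simps)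
  }
qed

lemma separating_functional:
  fixes A :: "'a::real_normed_vector set"
  assumes A: "subspace A" "closed A" and x: "x \<notin> A"
  obtains \<psi> where "linear \<psi>" "\<And>y. \<bar>\<psi> y\<bar> \<le> norm y" "\<And>y. y \<in> A \<Longrightarrow> \<psi> y = (0::real)" "\<psi> x \<noteq> 0"
proof -
  have 0: "0 \<in> A" by (rule subspace_0[OF A(1)])
  obtain p where p: "sublinear p" "\<And>y. p y \<le> infdist y A" "p (- x) \<le> - infdist x A"
    using sublinear_tilt[OF sublinear_infdist[OF A(1)]] by blast
  obtain \<psi> where \<psi>: "linear \<psi>" "\<And>y. \<psi> y \<le> p y" using linear_below_sublinear[OF p(1)] by blast
  have le: "\<psi> y \<le> infdist y A" for y using \<psi>(2) p(2) order_trans by blast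
  have neg: "\<psi> (- y) = - \<psi> y" for y by (rule linear_neg[OF \<psi>(1)])
  have "infdist y A \<le> norm y" for y using infdist_le[OF 0, of y] by simp
  then have "\<bar>\<psi> y\<bar> \<le> norm y" for y
    using le[of y] le[of "- y"] neg[of y] by (smt (verit) norm_minus_cancel)
  moreover have "\<psi> y = 0" if "y \<in> A" for y
    using le[of y] le[of "- y"] neg[of y] that subspace_neg[OF A(1) that] by simp
  moreover have "infdist x A > 0"
    using in_closed_iff_infdist_zero[OF A(2)] 0 x infdist_nonneg[of x A] by (metis empty_iff less_le)
  then have "\<psi> x \<noteq> 0" using \<psi>(2)[of "- x"] p(3) neg[of x] by simp
  ultimately show thesis using that \<psi>(1) by blast
qed

text \<open>
  A real functional \<open>f\<close> is complexified to \<open>f S - \<i> f (\<i> S)\<close>, which doubles the norm bound at most.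
\<close>
lemma separating_complex_functional:
  fixes A :: "'i op set"
  assumes A: "op_subspace A" "closed A" and T: "T \<notin> A"
  obtains \<psi> where "\<And>S S'. \<psi> (S + S') = \<psi> S + \<psi> S'" "\<And>c S. \<psi> (op_scaleC c S) = c * \<psi> S"
    "\<And>S. cmod (\<psi> S) \<le> 2 * norm S" "\<And>S. S \<in> A \<Longrightarrow> \<psi> S = 0" "\<psi> T \<noteq> 0"
proof -
  have "subspace A"
    using A(1) by (metis op.subspace_def op_scaleC_of_real subspace_def)
  then obtain f where f: "linear f" "\<And>S. \<bar>f S\<bar> \<le> norm S" "\<And>S. S \<in> A \<Longrightarrow> f S = 0" "f T \<noteq> 0"
    using separating_functional[OF _ A(2) T] by blast
  define \<psi> where "\<psi> S = Complex (f S) (- f (op_scaleC \<i> S))" for S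
  note lin = linear_add[OF f(1)] linear_scale[OF f(1)] linear_neg[OF f(1)]
  show thesis
  proof
    show "\<psi> (S + S') = \<psi> S + \<psi> S'" for S S'
      by (simp add: \<psi>_def complex_eq_iff lin op.scale_right_distrib)
    show "\<psi> (op_scaleC c S) = c * \<psi> S" for c S
    proof -
      have "op_scaleC c S = op_scaleC (of_real (Re c)) S + op_scaleC (of_real (Im c)) (op_scaleC \<i> S)"
        by (simp add: complex_eq op.scale_left_distrib[symmetric] mult.commute)
      moreover have "op_scaleC \<i> (op_scaleC c S)
          = op_scaleC (of_real (Re c)) (op_scaleC \<i> S) + op_scaleC (of_real (- Im c)) S"
      proof -
        have "\<i> * c = of_real (Re c) * \<i> + of_real (- Im c)" by (simp add: complex_eq_iff)
        then show ?thesis by (simp only: op.scale_scale op.scale_left_distrib)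
      qed
      ultimately show ?thesis
        by (simp only: \<psi>_def op_scaleC_of_real lin) (simp add: complex_eq_iff)
    qed
    show "cmod (\<psi> S) \<le> 2 * norm S" for S
    proof -
      have "cmod (\<psi> S) \<le> \<bar>f S\<bar> + \<bar>f (op_scaleC \<i> S)\<bar>"
        using cmod_le[of "\<psi> S"] by (simp add: \<psi>_def)
      then show ?thesis
        using f(2)[of S] f(2)[of "op_scaleC \<i> S"] norm_op_scaleC_i_le[of S] by linarith
    qed
    show "\<psi> S = 0" if "S \<in> A" for S
      using that A(1) by (simp add: \<psi>_def f(3) op.subspace_def complex_eq_iff)
    show "\<psi> T \<noteq> 0" using f(4) by (simp add: \<psi>_def complex_eq_iff)
  qed
qed


section \<open>Completely bounded multipliers as Schur multipliers\<close>

text \<open>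
  The matrices over the group ring that arise from Schur multipliers have one group element in each
  entry.
\<close>
lemma reg_matrix_apply_single_coefficients:
  fixes d :: "nat \<Rightarrow> nat \<Rightarrow> 'g::group_add"
  shows "ell2_apply (blinfun_apply (reg_matrix n (\<lambda>i j g. if g = d i j then c i j else 0)) \<zeta>) (k, s)
    = (if k < n then \<Sum>j<n. c k j * ell2_apply \<zeta> (j, - d k j + s) else 0)"
proof -
  have "(\<Sum>g | (if g = d i j then c i j else 0) \<noteq> 0. op_scaleC (if g = d i j then c i j else 0) (unit_reg i j g))
      = op_scaleC (c i j) (unit_reg i j (d i j))" for i j
  proof (cases "c i j = 0")
    case False
    then have "{g. (if g = d i j then c i j else 0) \<noteq> 0} = {d i j}" by auto
    then show ?thesis by simp
  qed simp
  then have "reg_matrix n (\<lambda>i j g. if g = d i j then c i j else 0)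
      = (\<Sum>i<n. \<Sum>j<n. op_scaleC (c i j) (unit_reg i j (d i j)))"
    by (simp add: reg_matrix_def)
  then have "ell2_apply (blinfun_apply (reg_matrix n (\<lambda>i j g. if g = d i j then c i j else 0)) \<zeta>) (k, s)
      = (\<Sum>i<n. \<Sum>j<n. c i j * (if k = i then ell2_apply \<zeta> (j, - d i j + s) else 0))"
    by (simp add: blinfun.sum_left ell2_apply_sum op_scaleC_apply unit_reg_apply)
  also have "\<dots> = (\<Sum>i<n. if k = i then \<Sum>j<n. c i j * ell2_apply \<zeta> (j, - d i j + s) else 0)"
    by (intro sum.cong refl) auto
  finally show ?thesis by simp
qed

text \<open>
  Let \<open>D\<close> be the diagonal of the translations by \<open>t 0, t 1, \<dots>\<close>.  The matrix with entry
  \<open>c k j\<close> at the group element \<open>t k - t j\<close> is \<open>D (c \<otimes> 1) D\<^sup>*\<close>, so it has the norm of the scalar matrix \<open>c\<close>,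
  while a multiplier \<open>\<phi>\<close> multiplies its \<open>(k, j)\<close> entry by \<open>\<phi> (t k - t j)\<close>.  Hence the bound on the
  amplifications of \<open>\<phi>\<close> is a bound for the Schur multiplier \<open>\<phi> (t k - t j)\<close> on scalar matrices.
\<close>
lemma schur_multiplier_bound:
  fixes t :: "nat \<Rightarrow> 'g::group_add" and c :: "nat \<Rightarrow> nat \<Rightarrow> complex"
  assumes \<phi>: "cb_multiplier_bound \<phi> C" and "0 \<le> K"
    and c: "\<And>w. (\<Sum>k<n. (cmod (\<Sum>j<n. c k j * w j))\<^sup>2) \<le> K\<^sup>2 * (\<Sum>j<n. (cmod (w j))\<^sup>2)"
  shows "(\<Sum>k<n. (cmod (\<Sum>j<n. \<phi> (t k - t j) * c k j * w j))\<^sup>2) \<le> (C * K)\<^sup>2 * (\<Sum>j<n. (cmod (w j))\<^sup>2)"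
proof -
  define a where "a i j g = (if g = t i - t j then c i j else 0)" for i j g
  let ?R = "reg_matrix n a" and ?R' = "reg_matrix n (\<lambda>i j g. \<phi> g * a i j g)"
  have shift: "- (t k - t j) + (t k + r) = t j + r" for j k r
    by (simp add: minus_diff_eq diff_add_eq_diff_diff_swap add.assoc[symmetric])
  have R: "ell2_apply (blinfun_apply ?R \<zeta>) (k, t k + r)
      = (if k < n then \<Sum>j<n. c k j * ell2_apply \<zeta> (j, t j + r) else 0)" for \<zeta> k r
    unfolding a_def[abs_def] reg_matrix_apply_single_coefficients shift ..
  have "(\<lambda>i j g. \<phi> g * a i j g) = (\<lambda>i j g. if g = t i - t j then \<phi> (t i - t j) * c i j else 0)"
    by (auto simp: a_def fun_eq_iff)
  then have R': "ell2_apply (blinfun_apply ?R' \<zeta>) (k, t k + r)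
      = (if k < n then \<Sum>j<n. \<phi> (t k - t j) * c k j * ell2_apply \<zeta> (j, t j + r) else 0)" for \<zeta> k r
    by (simp only: reg_matrix_apply_single_coefficients shift)
  have "norm ?R \<le> K"
  proof (rule norm_op_leI[OF \<open>0 \<le> K\<close>])
    fix \<zeta> :: "(nat \<times> 'g) ell2" and A :: "(nat \<times> 'g) set" assume "finite A"
    \<comment> \<open>In the coordinates \<open>s = t k + r\<close> the operator acts by the scalar matrix \<open>c\<close> for each \<open>r\<close> separately.\<close>
    define S where "S = (\<lambda>(k, s). - t k + s) ` A"
    define m where "m z = (case z of (k, r) \<Rightarrow> (k, t k + r))" for z :: "nat \<times> 'g"
    have m: "m (k, r) = (k, t k + r)" for k r by (simp add: m_def)
    have S: "finite S" using \<open>finite A\<close> by (simp add: S_def)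
    have inj: "inj_on m Z" for Z by (auto simp: inj_on_def m_def)
    have "(\<Sum>z\<in>A. (cmod (ell2_apply (blinfun_apply ?R \<zeta>) z))\<^sup>2)
        \<le> (\<Sum>z\<in>A \<union> m ` ({..<n} \<times> S). (cmod (ell2_apply (blinfun_apply ?R \<zeta>) z))\<^sup>2)"
      using S \<open>finite A\<close> by (intro sum_mono2) auto
    also have "\<dots> = (\<Sum>z\<in>m ` ({..<n} \<times> S). (cmod (ell2_apply (blinfun_apply ?R \<zeta>) z))\<^sup>2)"
    proof (intro sum.mono_neutral_right ballI)
      fix z assume z: "z \<in> A \<union> m ` ({..<n} \<times> S) - m ` ({..<n} \<times> S)"
      obtain k s where ks: "z = (k, s)" by (cases z)
      then have "- t k + s \<in> S" "z = m (k, - t k + s)"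
        using z by (force simp: S_def m_def add.assoc[symmetric])+
      then have "\<not> k < n" using z by auto
      then show "(cmod (ell2_apply (blinfun_apply ?R \<zeta>) z))\<^sup>2 = 0"
        using R[of \<zeta> k "- t k + s"] ks by (simp add: add.assoc[symmetric])
    qed (use S \<open>finite A\<close> in auto)
    also have "\<dots> = (\<Sum>k<n. \<Sum>r\<in>S. (cmod (\<Sum>j<n. c k j * ell2_apply \<zeta> (j, t j + r)))\<^sup>2)"
      by (simp add: sum.reindex[OF inj] sum.cartesian_product' m R)
    also have "\<dots> = (\<Sum>r\<in>S. \<Sum>k<n. (cmod (\<Sum>j<n. c k j * ell2_apply \<zeta> (j, t j + r)))\<^sup>2)"
      by (rule sum.swap)
    also have "\<dots> \<le> (\<Sum>r\<in>S. K\<^sup>2 * (\<Sum>j<n. (cmod (ell2_apply \<zeta> (j, t j + r)))\<^sup>2))"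
      by (intro sum_mono c)
    also have "\<dots> = K\<^sup>2 * (\<Sum>j<n. \<Sum>r\<in>S. (cmod (ell2_apply \<zeta> (j, t j + r)))\<^sup>2)"
      by (subst sum.swap) (simp add: sum_distrib_left)
    also have "\<dots> = K\<^sup>2 * (\<Sum>z\<in>m ` ({..<n} \<times> S). (cmod (ell2_apply \<zeta> z))\<^sup>2)"
      by (simp add: sum.reindex[OF inj] sum.cartesian_product' m)
    also have "\<dots> \<le> K\<^sup>2 * (norm \<zeta>)\<^sup>2"
      using S by (intro mult_left_mono sum_le_norm_ell2_sq) auto
    finally show "(\<Sum>z\<in>A. (cmod (ell2_apply (blinfun_apply ?R \<zeta>) z))\<^sup>2) \<le> K\<^sup>2 * (norm \<zeta>)\<^sup>2" .
  qed
  moreover have "finite_support (a i j)" for i j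
    unfolding finite_support_def by (rule finite_subset[of _ "{t i - t j}"]) (auto simp: a_def)
  then have "norm ?R' \<le> C * norm ?R" "0 \<le> C"
    using \<phi> unfolding cb_multiplier_bound_def by blast+
  ultimately have nR': "norm ?R' \<le> C * K"
    by (meson mult_left_mono order_trans)
  \<comment> \<open>The scalar matrix is recovered at \<open>r = 0\<close>, on vectors supported at the points \<open>(j, t j)\<close>.\<close>
  define D where "D = (\<lambda>j. (j, t j)) ` {..<n}"
  define \<zeta> where "\<zeta> = fin_vec (\<lambda>(j, s). w j) D"
  have D: "finite D" and inj: "inj_on (\<lambda>j. (j, t j)) {..<n}" by (auto simp: D_def inj_on_def)
  have \<zeta>: "ell2_apply \<zeta> (j, t j) = w j" if "j < n" for j
    using that by (simp add: \<zeta>_def fin_vec_apply[OF D]) (simp add: D_def)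
  have n\<zeta>: "(norm \<zeta>)\<^sup>2 = (\<Sum>j<n. (cmod (w j))\<^sup>2)"
    by (simp add: \<zeta>_def norm_fin_vec_sq[OF D]) (simp add: D_def sum.reindex[OF inj])
  have "(\<Sum>k<n. (cmod (\<Sum>j<n. \<phi> (t k - t j) * c k j * w j))\<^sup>2)
      = (\<Sum>z\<in>D. (cmod (ell2_apply (blinfun_apply ?R' \<zeta>) z))\<^sup>2)"
    using R'[of \<zeta> _ 0] by (simp add: D_def sum.reindex[OF inj] \<zeta>)
  also have "\<dots> \<le> (norm (blinfun_apply ?R' \<zeta>))\<^sup>2" by (rule sum_le_norm_ell2_sq[OF D])
  also have "\<dots> \<le> (C * K * norm \<zeta>)\<^sup>2"
    by (intro power_mono order_trans[OF norm_blinfun] mult_right_mono nR') auto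
  finally show ?thesis by (simp add: power_mult_distrib n\<zeta>)
qed


section \<open>Slices and their coefficients\<close>

definition slice :: "('g::group_add \<Rightarrow> 'x::topological_space \<Rightarrow> 'x) \<Rightarrow> 'g \<Rightarrow> ('x \<Rightarrow> complex) \<Rightarrow> ('g \<times> 'x) op" where
  "slice act g f = unitary_op g o\<^sub>L func_op act f"

text \<open>
  The function \<open>E(u\<^sub>g\<^sup>* T)\<close> for the canonical conditional expectation \<open>E\<close> onto \<open>C(X)\<close>: evaluating \<open>T\<close> at the
  basis vector over the unit at \<open>x\<close> makes sense for every operator, and gives \<open>f x\<close> for \<open>T = u\<^sub>g f\<close>.
\<close>
definition coef :: "('g::group_add \<times> 'x) op \<Rightarrow> 'g \<Rightarrow> 'x \<Rightarrow> complex" where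
  "coef T g x = ell2_apply (blinfun_apply T (fin_vec (\<lambda>_. 1) {(0, x)})) (g, x)"

lemma coef_zero: "coef 0 g x = 0"
  by (simp add: coef_def zero_ell2.rep_eq)

lemma coef_add: "coef (S + T) g x = coef S g x + coef T g x"
  by (simp add: coef_def blinfun.add_left plus_ell2.rep_eq)

lemma coef_diff: "coef (S - T) g x = coef S g x - coef T g x"
  by (simp add: coef_def blinfun.diff_left minus_ell2.rep_eq)

lemma coef_scaleC: "coef (op_scaleC c T) g x = c * coef T g x"
  by (simp add: coef_def op_scaleC_apply)

lemma cmod_coef_le: "cmod (coef T g x) \<le> norm T"
proof -
  have "cmod (coef T g x) \<le> norm (blinfun_apply T (fin_vec (\<lambda>_. 1) {(0, x)}))"
    unfolding coef_def by (rule cmod_ell2_apply_le)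
  also have "\<dots> \<le> norm T"
    using norm_blinfun[of T "fin_vec (\<lambda>_. 1) {(0, x)}"] by (simp add: norm_fin_vec_single)
  finally show ?thesis .
qed

locale compact_action =
  fixes act :: "'g::group_add \<Rightarrow> 'x::t2_space \<Rightarrow> 'x"
  assumes compact_space: "compact (UNIV :: 'x set)"
    and action: "action_by_homeomorphisms act"
begin

lemma act_zero [simp]: "act 0 x = x"
  and act_add: "act (g + h) x = act g (act h x)"
  using action by (auto simp: action_by_homeomorphisms_def)

lemma act_minus [simp]: "act (- g) (act g x) = x" "act g (act (- g) x) = x"
  using act_add[of "- g" g x] act_add[of g "- g" x] by simp_all

lemma continuous_on_comp_act:
  assumes "continuous_on UNIV f"
  shows "continuous_on UNIV (\<lambda>x. f (act g x))"
proof -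
  have "continuous_on UNIV (act g)"
    using action by (auto simp: action_by_homeomorphisms_def homeomorphism_def)
  then show ?thesis using assms by (auto intro: continuous_on_compose2)
qed

lemma slice_apply:
  assumes "continuous_on UNIV f"
  shows "ell2_apply (blinfun_apply (slice act g f) \<xi>) (h, x)
    = f (act (- g + h) x) * ell2_apply \<xi> (- g + h, x)"
  by (simp add: slice_def unitary_op_apply func_op_apply[OF compact_space assms])

lemma slice_0:
  assumes "continuous_on UNIV f"
  shows "slice act 0 f = func_op act f"
  by (intro blinfun_eqI ell2_eqI) (auto simp: slice_apply func_op_apply compact_space assms)

lemma slice_zero_fun: "slice act g (\<lambda>_. 0) = 0"
  by (intro blinfun_eqI ell2_eqI) (auto simp: slice_apply zero_ell2.rep_eq)

lemma slice_add:
  assumes "continuous_on UNIV f" "continuous_on UNIV k"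
  shows "slice act g (\<lambda>x. f x + k x) = slice act g f + slice act g k"
  by (intro blinfun_eqI ell2_eqI)
    (auto simp: slice_apply continuous_on_add assms blinfun.add_left plus_ell2.rep_eq algebra_simps)

lemma slice_diff:
  assumes "continuous_on UNIV f" "continuous_on UNIV k"
  shows "slice act g (\<lambda>x. f x - k x) = slice act g f - slice act g k"
  by (intro blinfun_eqI ell2_eqI)
    (auto simp: slice_apply continuous_on_diff assms blinfun.diff_left minus_ell2.rep_eq algebra_simps)

lemma slice_scaleC:
  assumes "continuous_on UNIV f"
  shows "slice act g (\<lambda>x. c * f x) = op_scaleC c (slice act g f)"
  by (intro blinfun_eqI ell2_eqI) (auto simp: slice_apply continuous_on_mult_left assms op_scaleC_apply)

lemma slice_sum:
  assumes "\<And>i. i \<in> I \<Longrightarrow> continuous_on UNIV (f i)"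
  shows "slice act g (\<lambda>x. \<Sum>i\<in>I. f i x) = (\<Sum>i\<in>I. slice act g (f i))"
  using assms
  by (induction I rule: infinite_finite_induct)
    (simp_all add: slice_zero_fun slice_add continuous_on_sum)

lemma slice_mult:
  assumes "continuous_on UNIV f" "continuous_on UNIV k"
  shows "slice act g f o\<^sub>L slice act h k = slice act (g + h) (\<lambda>x. f (act h x) * k x)"
proof (intro blinfun_eqI ell2_eqI)
  fix \<xi> and z :: "'g \<times> 'x" obtain s x where z: "z = (s, x)" by (cases z)
  have "act h (act (- h + (- g + s)) x) = act (- g + s) x"
    by (simp add: act_add)
  moreover have "- (g + h) + s = - h + (- g + s)" by (simp only: minus_add add.assoc)
  ultimately show "ell2_apply (blinfun_apply (slice act g f o\<^sub>L slice act h k) \<xi>) z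
      = ell2_apply (blinfun_apply (slice act (g + h) (\<lambda>x. f (act h x) * k x)) \<xi>) z"
    using assms by (simp add: z slice_apply continuous_on_mult continuous_on_comp_act)
qed

lemma is_adjoint_slice:
  assumes f: "continuous_on UNIV f"
  shows "is_adjoint (slice act g f) (slice act (- g) (\<lambda>x. cnj (f (act (- g) x))))"
  unfolding is_adjoint_def
proof (intro allI)
  fix \<xi> \<eta> :: "('g \<times> 'x) ell2"
  have f': "continuous_on UNIV (\<lambda>x. cnj (f (act (- g) x)))"
    by (intro continuous_on_cnj continuous_on_comp_act f)
  let ?\<sigma> = "\<lambda>(h, x). (- g + h, x)"
  let ?u = "\<lambda>(h, x). cnj (ell2_apply \<xi> (g + h, x)) * (f (act h x) * ell2_apply \<eta> (h, x))"
  have bij: "bij_betw ?\<sigma> (UNIV :: ('g \<times> 'x) set) UNIV"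
    by (rule bij_betw_byWitness[where f'="\<lambda>(h, x). (g + h, x)"]) (auto simp: add.assoc[symmetric])
  have "cinner_ell2 \<xi> (blinfun_apply (slice act g f) \<eta>) = (\<Sum>\<^sub>\<infinity>z. ?u (?\<sigma> z))"
    unfolding cinner_ell2.rep_eq
    by (intro infsum_cong) (auto simp: slice_apply[OF f] add.assoc[symmetric])
  also have "\<dots> = (\<Sum>\<^sub>\<infinity>z. ?u z)" by (rule infsum_reindex_bij_betw[OF bij])
  also have "\<dots> = cinner_ell2 (blinfun_apply (slice act (- g) (\<lambda>x. cnj (f (act (- g) x)))) \<xi>) \<eta>"
    unfolding cinner_ell2.rep_eq
    by (intro infsum_cong) (auto simp: slice_apply[OF f'] act_add)
  finally show "cinner_ell2 \<xi> (blinfun_apply (slice act g f) \<eta>)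
      = cinner_ell2 (blinfun_apply (slice act (- g) (\<lambda>x. cnj (f (act (- g) x)))) \<xi>) \<eta>" .
qed

lemma norm_slice_le:
  assumes f: "continuous_on UNIV f" and K: "\<And>x. cmod (f x) \<le> K"
  shows "norm (slice act g f) \<le> K"
proof (rule norm_op_leI)
  show "0 \<le> K" using K[of undefined] norm_ge_zero order_trans by blast
  fix \<xi> :: "('g \<times> 'x) ell2" and A :: "('g \<times> 'x) set" assume A: "finite A"
  let ?\<sigma> = "\<lambda>(h, x). (- g + h, x)"
  have inj: "inj_on ?\<sigma> A" by (auto simp: inj_on_def)
  have "(\<Sum>z\<in>A. (cmod (ell2_apply (blinfun_apply (slice act g f) \<xi>) z))\<^sup>2)
      \<le> (\<Sum>z\<in>A. K\<^sup>2 * (cmod (ell2_apply \<xi> (?\<sigma> z)))\<^sup>2)"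
    by (intro sum_mono)
      (auto simp: slice_apply[OF f] norm_mult power_mult_distrib intro!: mult_right_mono power_mono K)
  also have "\<dots> = K\<^sup>2 * (\<Sum>z\<in>?\<sigma> ` A. (cmod (ell2_apply \<xi> z))\<^sup>2)"
    by (simp add: sum.reindex[OF inj] sum_distrib_left)
  also have "\<dots> \<le> K\<^sup>2 * (norm \<xi>)\<^sup>2"
    using A by (intro mult_left_mono sum_le_norm_ell2_sq) auto
  finally show "(\<Sum>z\<in>A. (cmod (ell2_apply (blinfun_apply (slice act g f) \<xi>) z))\<^sup>2) \<le> K\<^sup>2 * (norm \<xi>)\<^sup>2" .
qed

lemma coef_slice:
  assumes "continuous_on UNIV f"
  shows "coef (slice act h f) g x = (if g = h then f x else 0)"
proof -
  have "- h + g = 0 \<longleftrightarrow> g = h" by (metis add_0_right add_minus_cancel minus_add_cancel)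
  then show ?thesis by (auto simp: coef_def slice_apply assms fin_vec_apply)
qed


section \<open>The algebraic crossed product\<close>

definition algebraic_crossed_product :: "('g \<times> 'x) op set" where
  "algebraic_crossed_product = op_span {slice act g f | g f. continuous_on UNIV f}"

lemma reduced_crossed_product_eq: "reduced_crossed_product act = closure algebraic_crossed_product"
proof -
  have "{func_op act f o\<^sub>L unitary_op g | g f. continuous_on UNIV f}
      = {slice act g f | g f. continuous_on UNIV f}"
  proof (intro equalityI subsetI)
    fix T assume "T \<in> {func_op act f o\<^sub>L unitary_op g | g f. continuous_on UNIV f}"
    then obtain g f where T: "T = func_op act f o\<^sub>L unitary_op g" and f: "continuous_on UNIV f" by blast
    then have "T = slice act g (\<lambda>x. f (act g x))"
      using covariance[OF compact_space continuous_on_comp_act[OF f] action, of g g] by (simp add: slice_def)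
    then show "T \<in> {slice act g f | g f. continuous_on UNIV f}"
      using continuous_on_comp_act[OF f] by blast
  next
    fix T assume "T \<in> {slice act g f | g f. continuous_on UNIV f}"
    then obtain g f where T: "T = slice act g f" and f: "continuous_on UNIV f" by blast
    then have "T = func_op act (\<lambda>x. f (act (- g) x)) o\<^sub>L unitary_op g"
      using covariance[OF compact_space f action] by (simp add: slice_def)
    then show "T \<in> {func_op act f o\<^sub>L unitary_op g | g f. continuous_on UNIV f}"
      using continuous_on_comp_act[OF f] by blast
  qed
  then show ?thesis by (simp add: reduced_crossed_product_def algebraic_crossed_product_def)
qed

lemma alg_expansion:
  assumes "T \<in> algebraic_crossed_product"
  obtains F where "finite F" "\<And>g. continuous_on UNIV (coef T g)"
    "\<And>g x. g \<notin> F \<Longrightarrow> coef T g x = 0" "T = (\<Sum>g\<in>F. slice act g (coef T g))"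
proof -
  have "(\<forall>g. continuous_on UNIV (coef T g)) \<and>
    (\<exists>F. finite F \<and> (\<forall>g x. g \<notin> F \<longrightarrow> coef T g x = 0) \<and> T = (\<Sum>g\<in>F. slice act g (coef T g)))"
    using assms unfolding algebraic_crossed_product_def
  proof (induction rule: op.span_induct_alt)
    case base
    then show ?case by (auto simp: coef_zero[abs_def] coef_zero intro!: exI[of _ "{}"])
  next
    case (step c S T)
    obtain h f where S: "S = slice act h f" and f: "continuous_on UNIV f" using step(1) by blast
    obtain F where F: "finite F" "\<And>g x. g \<notin> F \<Longrightarrow> coef T g x = 0" "T = (\<Sum>g\<in>F. slice act g (coef T g))"
      using step(2) by blast
    have T: "continuous_on UNIV (coef T g)" for g using step(2) by blast
    let ?R = "op_scaleC c S + T"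
    have coef: "coef ?R g = (if g = h then \<lambda>x. c * f x + coef T g x else coef T g)" for g
      by (auto simp: fun_eq_iff coef_add coef_scaleC S coef_slice[OF f])
    have cont: "continuous_on UNIV (\<lambda>x. c * f x)" by (intro continuous_intros f)
    have slice: "slice act g (coef ?R g) = (if g = h then op_scaleC c S else 0) + slice act g (coef T g)" for g
    proof (cases "g = h")
      case True
      then show ?thesis using slice_add[OF cont T, of h h] slice_scaleC[OF f, of h c] unfolding coef by (simp add: S)
    qed (unfold coef, simp)
    have "(\<Sum>g\<in>insert h F. slice act g (coef T g)) = T"
    proof -
      have "coef T g = (\<lambda>_. 0)" if "g \<notin> F" for g using F(2)[OF that] by blast
      then have "(\<Sum>g\<in>insert h F. slice act g (coef T g)) = (\<Sum>g\<in>F. slice act g (coef T g))"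
        using F(1) by (intro sum.mono_neutral_right) (auto simp: slice_zero_fun)
      then show ?thesis using F(3) by simp
    qed
    then have "?R = (\<Sum>g\<in>insert h F. slice act g (coef ?R g))"
      using F(1) by (simp add: slice sum.distrib del: sum.insert)
    moreover have "continuous_on UNIV (coef ?R g)" for g
      using continuous_on_add[OF cont T] T by (simp add: coef)
    moreover have "coef ?R g x = 0" if "g \<notin> insert h F" for g x
      using that F(2) by (simp add: coef)
    ultimately show ?case using F(1) by blast
  qed
  then show thesis using that by blast
qed

lemma alg_diff: "S \<in> algebraic_crossed_product \<Longrightarrow> T \<in> algebraic_crossed_product \<Longrightarrow> S - T \<in> algebraic_crossed_product"
  unfolding algebraic_crossed_product_def by (rule op.span_diff)

lemma crossed_product_approx:
  assumes "T \<in> reduced_crossed_product act" "e > 0"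
  obtains S where "S \<in> algebraic_crossed_product" "norm (T - S) < e"
  using assms unfolding reduced_crossed_product_eq closure_approachable dist_norm
  by (metis norm_minus_commute)

lemma continuous_coef:
  assumes "T \<in> reduced_crossed_product act"
  shows "continuous_on UNIV (coef T g)"
proof -
  obtain t where t: "\<And>n. t n \<in> algebraic_crossed_product" "t \<longlonglongrightarrow> T"
    using assms unfolding reduced_crossed_product_eq by (metis closure_sequential)
  have ul: "uniform_limit UNIV (\<lambda>n. coef (t n) g) (coef T g) sequentially"
  proof (rule uniform_limitI)
    fix e :: real assume "e > 0"
    have "\<forall>\<^sub>F n in sequentially. dist (t n) T < e" by (rule tendstoD[OF t(2) \<open>e > 0\<close>])
    then show "\<forall>\<^sub>F n in sequentially. \<forall>x\<in>UNIV. dist (coef (t n) g x) (coef T g x) < e"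
    proof eventually_elim
      case (elim n)
      have "dist (coef (t n) g x) (coef T g x) \<le> dist (t n) T" for x
        using cmod_coef_le[of "t n - T" g x] by (simp add: dist_norm coef_diff)
      then show ?case using elim by (auto intro: le_less_trans)
    qed
  qed
  have "\<forall>\<^sub>F n in sequentially. continuous_on UNIV (coef (t n) g)"
    using alg_expansion[OF t(1)] by (metis (mono_tags, lifting) always_eventually)
  then show ?thesis by (rule uniform_limit_theorem[OF _ ul]) simp
qed


section \<open>Recovering an operator from its slices\<close>
text \<open>
  On the vectors over a single \<open>x\<close>, the sum of slices \<open>u\<^sub>g coef T g\<close> is the matrix over \<open>\<Gamma>\<close> with entry
  \<open>coef T (h - q) (act q x)\<close> at \<open>(h, q)\<close>.  Multiplying the \<open>g\<close>-th slice by \<open>\<phi> g\<close> is Schur multiplication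
  by \<open>\<phi> (h - q)\<close>, which is bounded on finite corners of this matrix.
\<close>
lemma alg_multiplier_bound:
  assumes \<phi>: "cb_multiplier_bound \<phi> C" and T: "T \<in> algebraic_crossed_product"
    and F: "finite F" "\<And>g x. g \<notin> F \<Longrightarrow> coef T g x = 0"
  shows "norm (\<Sum>g\<in>F. op_scaleC (\<phi> g) (slice act g (coef T g))) \<le> C * norm T"
proof (rule norm_op_leI)
  have C: "0 \<le> C" using \<phi> by (simp add: cb_multiplier_bound_def)
  then show "0 \<le> C * norm T" by simp
  fix \<xi> :: "('g \<times> 'x) ell2" and A :: "('g \<times> 'x) set" assume A: "finite A"
  let ?M = "\<Sum>g\<in>F. op_scaleC (\<phi> g) (slice act g (coef T g))"
  obtain F' where F': "finite F'" "\<And>g. continuous_on UNIV (coef T g)"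
    "\<And>g x. g \<notin> F' \<Longrightarrow> coef T g x = 0" "T = (\<Sum>g\<in>F'. slice act g (coef T g))"
    using alg_expansion[OF T] by blast
  have "(\<Sum>g\<in>F'. slice act g (coef T g)) = (\<Sum>g\<in>F. slice act g (coef T g))"
  proof -
    have "coef T g = (\<lambda>_. 0)" if "g \<notin> F \<or> g \<notin> F'" for g using that F(2) F'(3) by blast
    then show ?thesis
      by (intro sum.mono_neutral_cong F(1) F'(1)) (auto simp: slice_zero_fun)
  qed
  then have T_eq: "T = (\<Sum>g\<in>F. op_scaleC 1 (slice act g (coef T g)))" using F'(4) by simp
  have entry: "ell2_apply (blinfun_apply (\<Sum>g\<in>F. op_scaleC (\<psi> g) (slice act g (coef T g))) \<zeta>) (h, x)
      = (\<Sum>q\<in>Q. \<psi> (h - q) * coef T (h - q) (act q x) * ell2_apply \<zeta> (q, x))"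
    if "finite Q" "\<And>g. g \<in> F \<Longrightarrow> - g + h \<notin> Q \<Longrightarrow> ell2_apply \<zeta> (- g + h, x) = 0" for Q \<psi> \<zeta> h x
  proof -
    let ?w = "\<lambda>q. \<psi> (h - q) * coef T (h - q) (act q x) * ell2_apply \<zeta> (q, x)"
    have inj: "inj_on (\<lambda>g. - g + h) F" by (auto simp: inj_on_def)
    have diff: "h - (- g + h) = g" for g
      by (simp add: diff_conv_add_uminus minus_add add.assoc[symmetric])
    have neg: "- (h - q) + h = q" for q by (simp add: minus_diff_eq)
    have "ell2_apply (blinfun_apply (\<Sum>g\<in>F. op_scaleC (\<psi> g) (slice act g (coef T g))) \<zeta>) (h, x)
        = (\<Sum>g\<in>F. ?w (- g + h))"
      by (simp add: blinfun.sum_left ell2_apply_sum op_scaleC_apply slice_apply F'(2) diff mult.assoc)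
    also have "\<dots> = sum ?w ((\<lambda>g. - g + h) ` F)" by (simp add: sum.reindex[OF inj])
    also have "\<dots> = sum ?w Q"
    proof (intro sum.mono_neutral_cong)
      fix q assume "q \<in> Q - (\<lambda>g. - g + h) ` F"
      then have "h - q \<notin> F" using neg[of q] by (metis DiffD2 imageI)
      then show "?w q = 0" using F(2) by simp
    qed (use that F(1) in auto)
    finally show ?thesis .
  qed
  \<comment> \<open>\<open>Q\<close> contains the rows \<open>P\<close> to be estimated and all columns that contribute to them.\<close>
  define P where "P = fst ` A"
  define Y where "Y = snd ` A"
  define Q where "Q = P \<union> (\<lambda>(g, h). - g + h) ` (F \<times> P)"
  have fin: "finite P" "finite Y" "finite Q" using A F(1) by (auto simp: P_def Y_def Q_def)
  obtain t n where t: "bij_betw t {..<n::nat} Q"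
    using ex_bij_betw_nat_finite[OF fin(3)] by (auto simp: atLeast0LessThan)
  note reindex = sum.reindex_bij_betw[OF t, symmetric]
  have row: "(\<Sum>h\<in>P. (cmod (ell2_apply (blinfun_apply ?M \<xi>) (h, x)))\<^sup>2)
      \<le> (C * norm T)\<^sup>2 * (\<Sum>q\<in>Q. (cmod (ell2_apply \<xi> (q, x)))\<^sup>2)" for x
  proof -
    define c where "c k j = coef T (t k - t j) (act (t j) x)" for k j
    have "(\<Sum>h\<in>P. (cmod (ell2_apply (blinfun_apply ?M \<xi>) (h, x)))\<^sup>2)
        = (\<Sum>h\<in>P. (cmod (\<Sum>q\<in>Q. \<phi> (h - q) * coef T (h - q) (act q x) * ell2_apply \<xi> (q, x)))\<^sup>2)"
      by (intro sum.cong refl arg_cong[where f="\<lambda>z. (cmod z)\<^sup>2"] entry fin) (auto simp: Q_def)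
    also have "\<dots> \<le> (\<Sum>h\<in>Q. (cmod (\<Sum>q\<in>Q. \<phi> (h - q) * coef T (h - q) (act q x) * ell2_apply \<xi> (q, x)))\<^sup>2)"
      by (intro sum_mono2 fin) (auto simp: Q_def)
    also have "\<dots> = (\<Sum>k<n. (cmod (\<Sum>j<n. \<phi> (t k - t j) * c k j * ell2_apply \<xi> (t j, x)))\<^sup>2)"
      by (simp only: reindex c_def)
    also have "\<dots> \<le> (C * norm T)\<^sup>2 * (\<Sum>j<n. (cmod (ell2_apply \<xi> (t j, x)))\<^sup>2)"
    proof (rule schur_multiplier_bound[OF \<phi> norm_ge_zero])
      fix w :: "nat \<Rightarrow> complex"
      define v where "v = (\<lambda>(q, y::'x). w (the_inv_into {..<n} t q))"
      define \<zeta> where "\<zeta> = fin_vec v (Q \<times> {x})"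
      have v: "v (t j, y) = w j" if "j < n" for j y
        using that t by (simp add: v_def the_inv_into_f_f bij_betw_def)
      have fQ: "finite (Q \<times> {x})" using fin by simp
      have \<zeta>: "ell2_apply \<zeta> (q, x) = (if q \<in> Q then v (q, x) else 0)" for q
        by (simp add: \<zeta>_def fin_vec_apply[OF fQ])
      have "(\<Sum>k<n. (cmod (\<Sum>j<n. c k j * w j))\<^sup>2)
          = (\<Sum>k<n. (cmod (\<Sum>j<n. 1 * coef T (t k - t j) (act (t j) x) * v (t j, x)))\<^sup>2)"
        by (intro sum.cong refl arg_cong[where f="\<lambda>z. (cmod z)\<^sup>2"]) (simp add: c_def v)
      also have "\<dots> = (\<Sum>h\<in>Q. (cmod (\<Sum>q\<in>Q. 1 * coef T (h - q) (act q x) * v (q, x)))\<^sup>2)"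
        by (simp only: reindex)
      also have "\<dots> = (\<Sum>h\<in>Q. (cmod (\<Sum>q\<in>Q. 1 * coef T (h - q) (act q x) * ell2_apply \<zeta> (q, x)))\<^sup>2)"
        by (intro sum.cong refl arg_cong[where f="\<lambda>z. (cmod z)\<^sup>2"]) (simp add: \<zeta>)
      also have "\<dots> = (\<Sum>h\<in>Q. (cmod (ell2_apply (blinfun_apply T \<zeta>) (h, x)))\<^sup>2)"
        by (subst (2) T_eq, intro sum.cong refl arg_cong[where f="\<lambda>z. (cmod z)\<^sup>2"] entry[symmetric] fin)
          (simp add: \<zeta>)
      also have "\<dots> = (\<Sum>z\<in>Q \<times> {x}. (cmod (ell2_apply (blinfun_apply T \<zeta>) z))\<^sup>2)"
        by (simp add: sum.cartesian_product')
      also have "\<dots> \<le> (norm (blinfun_apply T \<zeta>))\<^sup>2" by (rule sum_le_norm_ell2_sq[OF fQ])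
      also have "\<dots> \<le> (norm T * norm \<zeta>)\<^sup>2" by (intro power_mono norm_blinfun) auto
      also have "\<dots> = (norm T)\<^sup>2 * (\<Sum>q\<in>Q. (cmod (v (q, x)))\<^sup>2)"
        by (simp add: power_mult_distrib \<zeta>_def norm_fin_vec_sq[OF fQ] sum.cartesian_product')
      also have "(\<Sum>q\<in>Q. (cmod (v (q, x)))\<^sup>2) = (\<Sum>j<n. (cmod (w j))\<^sup>2)"
        unfolding reindex by (intro sum.cong) (auto simp: v)
      finally show "(\<Sum>k<n. (cmod (\<Sum>j<n. c k j * w j))\<^sup>2) \<le> (norm T)\<^sup>2 * (\<Sum>j<n. (cmod (w j))\<^sup>2)" .
    qed
    finally show ?thesis by (simp only: reindex)
  qed
  have "(\<Sum>z\<in>A. (cmod (ell2_apply (blinfun_apply ?M \<xi>) z))\<^sup>2)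
      \<le> (\<Sum>z\<in>P \<times> Y. (cmod (ell2_apply (blinfun_apply ?M \<xi>) z))\<^sup>2)"
    using fin by (intro sum_mono2) (force simp: P_def Y_def)+
  also have "\<dots> = (\<Sum>x\<in>Y. \<Sum>h\<in>P. (cmod (ell2_apply (blinfun_apply ?M \<xi>) (h, x)))\<^sup>2)"
    unfolding sum.cartesian_product' by (rule sum.swap)
  also have "\<dots> \<le> (\<Sum>x\<in>Y. (C * norm T)\<^sup>2 * (\<Sum>q\<in>Q. (cmod (ell2_apply \<xi> (q, x)))\<^sup>2))"
    by (intro sum_mono row)
  also have "\<dots> = (C * norm T)\<^sup>2 * (\<Sum>z\<in>Q \<times> Y. (cmod (ell2_apply \<xi> z))\<^sup>2)"
    unfolding sum.cartesian_product' by (subst sum.swap) (simp add: sum_distrib_left)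
  also have "\<dots> \<le> (C * norm T)\<^sup>2 * (norm \<xi>)\<^sup>2"
    using fin by (intro mult_left_mono sum_le_norm_ell2_sq) auto
  finally show "(\<Sum>z\<in>A. (cmod (ell2_apply (blinfun_apply ?M \<xi>) z))\<^sup>2) \<le> (C * norm T)\<^sup>2 * (norm \<xi>)\<^sup>2" .
qed

text \<open>
  The formal series of slices of \<open>T\<close> need not converge to \<open>T\<close>.  Suppose that a functional \<open>\<psi>\<close> vanishes on
  the slices and not at \<open>T\<close>.  Then \<open>\<omega> \<phi> = \<psi> (M\<^sub>\<phi> T)\<close>, where \<open>M\<^sub>\<phi>\<close> multiplies the \<open>g\<close>-th slice by \<open>\<phi> g\<close>,
  lies in the predual of the completely bounded multipliers: replacing \<open>T\<close> by a finite sum of slices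
  turns it into a finitely supported element of \<open>\<ell>\<^sup>1(\<Gamma>)\<close>, with an error controlled by the multiplier
  bound.  Now \<open>\<omega>\<close> vanishes at finitely supported \<open>\<phi>\<close>, and its value at \<open>1\<close> is \<open>\<psi> T\<close>; the approximation
  property forces \<open>\<psi> T = 0\<close>.
\<close>
lemma in_closure_span_slice_coef:
  assumes AP: "approximation_property TYPE('g)" and T: "T \<in> reduced_crossed_product act"
  shows "T \<in> closure (op_span (range (\<lambda>g. slice act g (coef T g))))"
proof (rule ccontr)
  define A where "A = closure (op_span (range (\<lambda>g. slice act g (coef T g))))"
  assume "T \<notin> closure (op_span (range (\<lambda>g. slice act g (coef T g))))"
  then have TA: "T \<notin> A" by (simp add: A_def)
  have "op_subspace A" "closed A" by (auto simp: A_def op_subspace_closure)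
  then obtain \<psi> where \<psi>: "\<And>S S'. \<psi> (S + S') = \<psi> S + \<psi> S'" "\<And>c S. \<psi> (op_scaleC c S) = c * \<psi> S"
    "\<And>S. cmod (\<psi> S) \<le> 2 * norm S" "\<And>S. S \<in> A \<Longrightarrow> \<psi> S = 0" "\<psi> T \<noteq> 0"
    using separating_complex_functional[OF _ _ TA] by metis
  have \<psi>0: "\<psi> 0 = 0" using \<psi>(3)[of 0] by simp
  have \<psi>sum: "\<psi> (\<Sum>g\<in>F. s g) = (\<Sum>g\<in>F. \<psi> (s g))" for F and s :: "'g \<Rightarrow> ('g \<times> 'x) op"
    by (induction F rule: infinite_finite_induct) (auto simp: \<psi>0 \<psi>(1))
  have \<psi>diff: "\<psi> (S - S') = \<psi> S - \<psi> S'" for S S'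
    using \<psi>(1)[of "S - S'" S'] by (simp add: algebra_simps)
  obtain t where t: "\<And>n. t n \<in> algebraic_crossed_product" "t \<longlonglongrightarrow> T"
    using T unfolding reduced_crossed_product_eq by (metis closure_sequential)
  have cT: "continuous_on UNIV (coef T g)" for g by (rule continuous_coef[OF T])
  have "\<forall>n. \<exists>F. finite F \<and> (\<forall>g. continuous_on UNIV (coef (t n) g)) \<and>
      (\<forall>g x. g \<notin> F \<longrightarrow> coef (t n) g x = 0) \<and> t n = (\<Sum>g\<in>F. slice act g (coef (t n) g))"
    using alg_expansion[OF t(1)] by metis
  then obtain F where F: "\<And>n. finite (F n)" "\<And>n g. continuous_on UNIV (coef (t n) g)"
      "\<And>n g x. g \<notin> F n \<Longrightarrow> coef (t n) g x = 0"
      "\<And>n. t n = (\<Sum>g\<in>F n. slice act g (coef (t n) g))"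
    by metis
  define a where "a n g = \<psi> (slice act g (coef (t n) g))" for n g
  define L where "L n \<phi> = (\<Sum>\<^sub>\<infinity>g. a n g * \<phi> g)" for n and \<phi> :: "'g \<Rightarrow> complex"
  \<comment> \<open>\<open>L n \<phi>\<close> is \<open>\<psi> (M\<^sub>\<phi> (t n))\<close>; the limit is a definition of \<open>\<psi> (M\<^sub>\<phi> T)\<close> that covers both the
    multipliers and the finitely supported functions without extending \<open>M\<^sub>\<phi>\<close> to the crossed product.\<close>
  define \<omega> where "\<omega> \<phi> = lim (\<lambda>n. L n \<phi>)" for \<phi>
  have a0: "a n g = 0" if "g \<notin> F n" for n g
  proof -
    have "coef (t n) g = (\<lambda>_. 0)" using F(3)[OF that] by blast
    then show ?thesis by (simp add: a_def slice_zero_fun \<psi>0)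
  qed
  have L_sum: "L n \<phi> = (\<Sum>g\<in>G. a n g * \<phi> g)" if "finite G" "\<And>g. g \<notin> G \<Longrightarrow> a n g * \<phi> g = 0" for n \<phi> G
  proof -
    have "L n \<phi> = (\<Sum>\<^sub>\<infinity>g\<in>G. a n g * \<phi> g)"
      unfolding L_def using that by (intro infsum_cong_neutral) auto
    then show ?thesis using that(1) by simp
  qed
  have L_diff: "cmod (L n \<phi> - L m \<phi>) \<le> cb_multiplier_norm \<phi> * (2 * norm (t n - t m))"
    if \<phi>: "cb_multiplier \<phi>" for n m \<phi>
  proof -
    let ?G = "F n \<union> F m"
    have "L n \<phi> = (\<Sum>g\<in>?G. a n g * \<phi> g)" "L m \<phi> = (\<Sum>g\<in>?G. a m g * \<phi> g)"
      by (rule L_sum; use F(1) a0 in simp)+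
    then have "L n \<phi> - L m \<phi> = (\<Sum>g\<in>?G. (a n g - a m g) * \<phi> g)"
      by (simp add: sum_subtractf algebra_simps)
    also have "\<dots> = (\<Sum>g\<in>?G. \<psi> (op_scaleC (\<phi> g) (slice act g (coef (t n - t m) g))))"
    proof (intro sum.cong refl)
      fix g
      have "slice act g (coef (t n - t m) g) = slice act g (coef (t n) g) - slice act g (coef (t m) g)"
        using slice_diff[OF F(2) F(2), of g n g m g] by (simp add: coef_diff[abs_def])
      then show "(a n g - a m g) * \<phi> g = \<psi> (op_scaleC (\<phi> g) (slice act g (coef (t n - t m) g)))"
        by (simp add: \<psi>(2) \<psi>diff a_def)
    qed
    also have "\<dots> = \<psi> (\<Sum>g\<in>?G. op_scaleC (\<phi> g) (slice act g (coef (t n - t m) g)))"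
      by (simp add: \<psi>sum)
    finally have L_eq: "L n \<phi> - L m \<phi> = \<psi> (\<Sum>g\<in>?G. op_scaleC (\<phi> g) (slice act g (coef (t n - t m) g)))" .
    have le: "cmod (L n \<phi> - L m \<phi>) \<le> C * (2 * norm (t n - t m))" if "cb_multiplier_bound \<phi> C" for C
    proof -
      have "norm (\<Sum>g\<in>?G. op_scaleC (\<phi> g) (slice act g (coef (t n - t m) g))) \<le> C * norm (t n - t m)"
        using F(1,3) by (intro alg_multiplier_bound[OF that] alg_diff t(1)) (auto simp: coef_diff)
      then show ?thesis
        unfolding L_eq
        using \<psi>(3)[of "\<Sum>g\<in>?G. op_scaleC (\<phi> g) (slice act g (coef (t n - t m) g))"] by linarith
    qed
    show ?thesis
    proof (cases "norm (t n - t m) = 0")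
      case True
      obtain C where "cb_multiplier_bound \<phi> C" using \<phi> by (auto simp: cb_multiplier_def)
      then show ?thesis using le[of C] True by simp
    next
      case False
      then have pos: "2 * norm (t n - t m) > 0" by simp
      have "cmod (L n \<phi> - L m \<phi>) / (2 * norm (t n - t m)) \<le> cb_multiplier_norm \<phi>"
        unfolding cb_multiplier_norm_def
        by (rule cInf_greatest) (use \<phi> le pos in \<open>auto simp: cb_multiplier_def pos_divide_le_eq\<close>)
      then show ?thesis using pos by (simp only: pos_divide_le_eq)
    qed
  qed
  have norm_nonneg: "0 \<le> cb_multiplier_norm \<phi>" if "cb_multiplier \<phi>" for \<phi> :: "'g \<Rightarrow> complex"
    unfolding cb_multiplier_norm_def
  proof (rule cInf_greatest)
    show "{C. cb_multiplier_bound \<phi> C} \<noteq> {}" using that by (simp add: cb_multiplier_def)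
  qed (simp add: cb_multiplier_bound_def)
  have close: "\<exists>m. \<forall>n\<ge>m. 2 * norm (t n - t m) \<le> e" if "e > 0" for e
  proof -
    obtain m where "\<And>n k. n \<ge> m \<Longrightarrow> k \<ge> m \<Longrightarrow> dist (t n) (t k) < e / 2"
      using LIMSEQ_imp_Cauchy[OF t(2)] \<open>e > 0\<close> by (meson metric_CauchyD half_gt_zero)
    then have "2 * norm (t n - t m) \<le> e" if "n \<ge> m" for n
      using that by (force simp: dist_norm)
    then show ?thesis by blast
  qed
  have L_lim: "(\<lambda>n. L n \<phi>) \<longlonglongrightarrow> \<omega> \<phi>" if \<phi>: "cb_multiplier \<phi>" for \<phi>
  proof -
    let ?N = "cb_multiplier_norm \<phi>"
    have "Cauchy (\<lambda>n. L n \<phi>)"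
    proof (rule metric_CauchyI)
      fix e :: real assume "e > 0"
      then have "e / (2 * (?N + 1)) > 0" using norm_nonneg[OF \<phi>] by simp
      then obtain k where k: "\<And>n m. n \<ge> k \<Longrightarrow> m \<ge> k \<Longrightarrow> dist (t n) (t m) < e / (2 * (?N + 1))"
        using LIMSEQ_imp_Cauchy[OF t(2)] by (meson metric_CauchyD)
      have "dist (L n \<phi>) (L m \<phi>) < e" if "n \<ge> k" "m \<ge> k" for n m
      proof -
        have "dist (L n \<phi>) (L m \<phi>) \<le> ?N * (2 * norm (t n - t m))"
          using L_diff[OF \<phi>] by (simp add: dist_norm)
        also have "\<dots> \<le> (?N + 1) * (2 * norm (t n - t m))" by (intro mult_right_mono) auto
        also have "\<dots> < e"
          using k[OF that] norm_nonneg[OF \<phi>] by (simp add: dist_norm field_simps)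
        finally show ?thesis .
      qed
      then show "\<exists>k. \<forall>n\<ge>k. \<forall>m\<ge>k. dist (L n \<phi>) (L m \<phi>) < e" by blast
    qed
    then show ?thesis unfolding \<omega>_def using Cauchy_convergent convergent_LIMSEQ_iff by blast
  qed
  have "predual_functional \<omega>"
    unfolding predual_functional_def
  proof (intro allI impI)
    fix \<epsilon> :: real assume "\<epsilon> > 0"
    then obtain m where m: "\<And>n. n \<ge> m \<Longrightarrow> 2 * norm (t n - t m) \<le> \<epsilon>" using close by blast
    have "(\<lambda>g. cmod (a m g)) summable_on UNIV"
    proof -
      have "(\<lambda>g. cmod (a m g)) summable_on F m" using F(1) by simp
      then show ?thesis by (rule summable_on_cong_neutral[THEN iffD1, rotated 3]) (auto simp: a0)
    qed
    moreover have "cmod (\<omega> \<phi> - (\<Sum>\<^sub>\<infinity>g. a m g * \<phi> g)) \<le> \<epsilon> * cb_multiplier_norm \<phi>"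
      if \<phi>: "cb_multiplier \<phi>" for \<phi>
    proof (rule Lim_bounded)
      show "(\<lambda>n. cmod (L n \<phi> - (\<Sum>\<^sub>\<infinity>g. a m g * \<phi> g))) \<longlonglongrightarrow> cmod (\<omega> \<phi> - (\<Sum>\<^sub>\<infinity>g. a m g * \<phi> g))"
        by (intro tendsto_intros L_lim[OF \<phi>])
      show "\<forall>n\<ge>m. cmod (L n \<phi> - (\<Sum>\<^sub>\<infinity>g. a m g * \<phi> g)) \<le> \<epsilon> * cb_multiplier_norm \<phi>"
      proof (intro allI impI)
        fix n assume "n \<ge> m"
        have "cmod (L n \<phi> - L m \<phi>) \<le> cb_multiplier_norm \<phi> * (2 * norm (t n - t m))" by (rule L_diff[OF \<phi>])
        also have "\<dots> \<le> cb_multiplier_norm \<phi> * \<epsilon>"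
          using norm_nonneg[OF \<phi>] m[OF \<open>n \<ge> m\<close>] by (intro mult_left_mono)
        finally show "cmod (L n \<phi> - (\<Sum>\<^sub>\<infinity>g. a m g * \<phi> g)) \<le> \<epsilon> * cb_multiplier_norm \<phi>"
          by (simp add: L_def mult.commute)
      qed
    qed
    ultimately show "\<exists>a. (\<lambda>g. cmod (a g)) summable_on UNIV \<and> (\<forall>\<phi>. cb_multiplier \<phi> \<longrightarrow>
        cmod (\<omega> \<phi> - (\<Sum>\<^sub>\<infinity>g. a g * \<phi> g)) \<le> \<epsilon> * cb_multiplier_norm \<phi>)" by blast
  qed
  then obtain \<F> :: "('g \<Rightarrow> complex) filter" where \<F>: "\<F> \<noteq> bot" "eventually finite_support \<F>"
    "(\<omega> \<longlongrightarrow> \<omega> (\<lambda>_. 1)) \<F>"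
    using AP unfolding approximation_property_def by blast
  have a_lim: "(\<lambda>n. a n g) \<longlonglongrightarrow> 0" for g
  proof -
    have "slice act g (coef T g) \<in> A" unfolding A_def by (intro closure_subset[THEN subsetD] op.span_base) blast
    then have "\<psi> (slice act g (coef T g)) = 0" by (rule \<psi>(4))
    moreover have "slice act g (coef (t n - T) g) = slice act g (coef (t n) g) - slice act g (coef T g)" for n
      using slice_diff[OF F(2) cT, of g n g g] by (simp add: coef_diff[abs_def])
    ultimately have "a n g = \<psi> (slice act g (coef (t n - T) g))" for n by (simp add: a_def \<psi>diff)
    moreover have "continuous_on UNIV (coef (t n - T) g)" for n
      using continuous_on_diff[OF F(2) cT] by (simp add: coef_diff[abs_def])
    then have "norm (slice act g (coef (t n - T) g)) \<le> norm (t n - T)" for n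
      by (intro norm_slice_le cmod_coef_le)
    ultimately have "cmod (a n g) \<le> 2 * norm (t n - T)" for n
      using \<psi>(3)[of "slice act g (coef (t n - T) g)"] by (smt (verit, best))
    moreover have "(\<lambda>n. 2 * norm (t n - T)) \<longlonglongrightarrow> 0"
      using t(2) by (intro tendsto_mult_right_zero tendsto_norm_zero) (simp add: LIM_zero)
    ultimately show ?thesis by (rule Lim_null_comparison[OF always_eventually[OF allI]])
  qed
  have "\<omega> \<phi> = 0" if "finite_support \<phi>" for \<phi>
  proof -
    have fin: "finite {g. \<phi> g \<noteq> 0}" using that by (simp add: finite_support_def)
    have "(\<lambda>n. \<Sum>g | \<phi> g \<noteq> 0. a n g * \<phi> g) \<longlonglongrightarrow> (\<Sum>g | \<phi> g \<noteq> 0. 0 * \<phi> g)"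
      by (intro tendsto_intros a_lim)
    moreover have "L n \<phi> = (\<Sum>g | \<phi> g \<noteq> 0. a n g * \<phi> g)" for n by (rule L_sum[OF fin]) simp
    ultimately have "(\<lambda>n. L n \<phi>) \<longlonglongrightarrow> 0" by simp
    then show ?thesis unfolding \<omega>_def by (rule limI)
  qed
  then have "eventually (\<lambda>\<phi>. \<omega> \<phi> = 0) \<F>" using \<F>(2) by (auto elim: eventually_mono)
  then have "(\<omega> \<longlongrightarrow> 0) \<F>" by (rule tendsto_eventually)
  then have "\<omega> (\<lambda>_. 1) = 0" using \<F> tendsto_unique by blast
  moreover have "\<omega> (\<lambda>_. 1) = \<psi> T"
  proof -
    have L1: "L n (\<lambda>_. 1) = \<psi> (t n)" for n
    proof -
      have "L n (\<lambda>_. 1) = (\<Sum>g\<in>F n. a n g * 1)" by (rule L_sum[OF F(1)]) (simp add: a0)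
      also have "\<dots> = \<psi> (\<Sum>g\<in>F n. slice act g (coef (t n) g))" by (simp add: a_def \<psi>sum)
      finally show ?thesis using F(4)[of n] by simp
    qed
    have "cmod (\<psi> (t n) - \<psi> T) \<le> 2 * norm (t n - T)" for n
      using \<psi>(3)[of "t n - T"] by (simp add: \<psi>diff)
    moreover have "(\<lambda>n. 2 * norm (t n - T)) \<longlonglongrightarrow> 0"
      using t(2) by (intro tendsto_mult_right_zero tendsto_norm_zero) (simp add: LIM_zero)
    ultimately have "(\<lambda>n. \<psi> (t n) - \<psi> T) \<longlonglongrightarrow> 0"
      by (rule Lim_null_comparison[OF always_eventually[OF allI]])
    then show ?thesis unfolding \<omega>_def L1 by (intro limI) (rule LIM_zero_cancel)
  qed
  ultimately show False using \<psi>(5) by simp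
qed

end

context compact_action
begin


section \<open>Functions on the space\<close>
lemma urysohn_function:
  assumes "open U" "x \<in> U"
  obtains f :: "'x \<Rightarrow> real" where "continuous_on UNIV f" "f x = 1" "\<And>y. y \<notin> U \<Longrightarrow> f y = 0"
proof -
  have "Hausdorff_space (euclidean :: 'x topology)"
    unfolding Hausdorff_space_def by (metis disjnt_def hausdorff open_openin)
  moreover have "compact_space (euclidean :: 'x topology)"
    using compact_space by (simp add: compact_space_def)
  ultimately have "normal_space (euclidean :: 'x topology)"
    using compact_Hausdorff_or_regular_imp_normal_space by blast
  moreover have "closedin euclidean (- U)" "closedin euclidean {x}" "disjnt (- U) {x}"
    using assms by (auto simp: disjnt_def)
  ultimately obtain f where "continuous_map euclidean euclideanreal f" "f ` (- U) \<subseteq> {0}" "f ` {x} \<subseteq> {1}"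
    using Urysohn_lemma_alt by metis
  then show thesis by (intro that[of f]) auto
qed

text \<open>
  An ideal of \<open>C(X)\<close> approximates every function supported in its open set, so a closed ideal
  contains it.  Finitely many members have no common zero on the compact set \<open>K\<close> where \<open>f\<close> is not small, so the ideal contains a function
  \<open>s \<ge> 0\<close> that is positive on \<open>K\<close>, and \<open>f s / (s + \<delta>)\<close> approximates \<open>f\<close> for small \<open>\<delta>\<close>.
\<close>
lemma ideal_approx:
  fixes D :: "('x \<Rightarrow> complex) set"
  assumes cont: "\<And>d. d \<in> D \<Longrightarrow> continuous_on UNIV d"
    and zero: "(\<lambda>_. 0) \<in> D"
    and add: "\<And>d d'. d \<in> D \<Longrightarrow> d' \<in> D \<Longrightarrow> (\<lambda>x. d x + d' x) \<in> D"
    and mult: "\<And>d k. d \<in> D \<Longrightarrow> continuous_on UNIV k \<Longrightarrow> (\<lambda>x. d x * k x) \<in> D"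
    and f: "continuous_on UNIV f" "\<And>x. f x \<noteq> 0 \<Longrightarrow> \<exists>d\<in>D. d x \<noteq> 0"
    and "e > 0"
  shows "\<exists>d\<in>D. \<forall>x. cmod (f x - d x) \<le> e"
proof (cases "{x. e \<le> cmod (f x)} = {}")
  case True
  then show ?thesis using zero by (intro bexI[of _ "\<lambda>_. 0"]) (auto simp: not_le intro: less_imp_le)
next
  case False
  define K where "K = {x. e \<le> cmod (f x)}"
  have "closed K" unfolding K_def by (intro closed_Collect_le continuous_intros f)
  then have K: "compact K" using compact_space by (metis compact_Int_closed inf_top_left)
  have "K \<subseteq> (\<Union>d\<in>D. {x. d x \<noteq> 0})"
  proof
    fix x assume "x \<in> K"
    then have "f x \<noteq> 0" using \<open>e > 0\<close> by (auto simp: K_def)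
    then show "x \<in> (\<Union>d\<in>D. {x. d x \<noteq> 0})" using f(2) by blast
  qed
  moreover have "open {x. d x \<noteq> 0}" if "d \<in> D" for d
    by (intro open_Collect_neq continuous_intros cont that)
  ultimately obtain D' where D': "D' \<subseteq> D" "finite D'" "K \<subseteq> (\<Union>d\<in>D'. {x. d x \<noteq> 0})"
    using compactE_image[OF K, of D "\<lambda>d. {x. d x \<noteq> 0}"] by metis
  define s where "s x = (\<Sum>d\<in>D'. (cmod (d x))\<^sup>2)" for x
  have s_D: "(\<lambda>x. of_real (s x)) \<in> D"
    using D'(2,1) unfolding s_def
  proof (induction D' rule: finite_induct)
    case (insert d D')
    have "(\<lambda>x. d x * cnj (d x)) \<in> D" using insert by (intro mult continuous_intros cont) auto
    then have "(\<lambda>x. of_real ((cmod (d x))\<^sup>2)) \<in> D" by (simp only: complex_norm_square)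
    then show ?case using insert add by simp
  qed (simp add: zero)
  have s_cont: "continuous_on UNIV s"
    unfolding s_def using D'(1) by (intro continuous_intros cont) auto
  have s_nonneg: "0 \<le> s x" for x unfolding s_def by (intro sum_nonneg) auto
  have "s x > 0" if "x \<in> K" for x
  proof -
    obtain d where "d \<in> D'" "d x \<noteq> 0" using \<open>x \<in> K\<close> D'(3) by blast
    then show ?thesis unfolding s_def by (intro sum_pos2[OF D'(2)]) auto
  qed
  moreover obtain x0 where "x0 \<in> K" "\<And>x. x \<in> K \<Longrightarrow> s x0 \<le> s x"
    using continuous_attains_inf[OF K _ continuous_on_subset[OF s_cont]] False by (auto simp: K_def)
  ultimately obtain c where c: "c > 0" "\<And>x. x \<in> K \<Longrightarrow> c \<le> s x" by blast
  have "bounded (range f)" by (rule compact_imp_bounded[OF compact_continuous_image[OF f(1) compact_space]])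
  then obtain M where M: "M > 0" "\<And>x. cmod (f x) \<le> M" by (auto simp: bounded_pos)
  \<comment> \<open>Where \<open>cmod (f x) < e\<close> any factor in the unit interval will do; on the compact rest \<open>s \<ge> c\<close>.\<close>
  define \<delta> where "\<delta> = c * e / M"
  have \<delta>: "\<delta> > 0" using c M \<open>e > 0\<close> by (simp add: \<delta>_def)
  have pos: "s x + \<delta> > 0" for x using s_nonneg[of x] \<delta> by linarith
  define k where "k x = f x / of_real (s x + \<delta>)" for x
  have "continuous_on UNIV k"
    unfolding k_def using pos by (intro continuous_intros f(1) s_cont) (metis less_irrefl of_real_eq_0_iff)
  then have "(\<lambda>x. of_real (s x) * k x) \<in> D" by (rule mult[OF s_D])
  moreover have "cmod (f x - of_real (s x) * k x) \<le> e" for x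
  proof -
    have "f x - of_real (s x) * k x = f x * of_real (\<delta> / (s x + \<delta>))"
      using pos[of x] by (simp add: k_def field_simps del: of_real_add) (simp add: algebra_simps)
    then have eq: "cmod (f x - of_real (s x) * k x) = cmod (f x) * (\<delta> / (s x + \<delta>))"
      using pos[of x] \<delta> by (simp add: norm_mult del: of_real_add of_real_divide)
    show ?thesis
    proof (cases "x \<in> K")
      case True
      have "c \<le> s x + \<delta>" using c(2)[OF True] \<delta> by linarith
      then have "\<delta> / (s x + \<delta>) \<le> \<delta> / c" using c(1) \<delta> pos[of x] by (intro divide_left_mono) simp_all
      then have "cmod (f x) * (\<delta> / (s x + \<delta>)) \<le> M * (\<delta> / c)"
        using M less_imp_le[OF \<delta>] less_imp_le[OF pos[of x]] by (intro mult_mono divide_nonneg_nonneg) simp_all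
      also have "\<dots> = e" using M c by (simp add: \<delta>_def)
      finally show ?thesis using eq by simp
    next
      case False
      have "\<delta> / (s x + \<delta>) \<le> 1" using s_nonneg[of x] pos[of x] by (simp only: pos_divide_le_eq) simp
      then have "cmod (f x) * (\<delta> / (s x + \<delta>)) \<le> cmod (f x)" by (intro mult_left_le) simp_all
      then show ?thesis using eq False by (simp add: K_def)
    qed
  qed
  ultimately show ?thesis by (intro bexI[of _ "\<lambda>x. of_real (s x) * k x"]) auto
qed

text \<open>
  A free action moves a small neighbourhood of each point off itself under each element of \<open>F\<close>; finitely
  many bump functions in such neighbourhoods are normalised.
\<close>
lemma moving_partition:
  assumes free: "free_action act" and F: "finite F" "0 \<notin> F"
  obtains I and l :: "'x \<Rightarrow> 'x \<Rightarrow> real" where "finite I" "\<And>i. continuous_on UNIV (l i)"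
    "\<And>x. (\<Sum>i\<in>I. (l i x)\<^sup>2) = 1" "\<And>i h x. h \<in> F \<Longrightarrow> l i (act h x) * l i x = 0"
proof -
  have "\<exists>p :: 'x \<Rightarrow> real. continuous_on UNIV p \<and> p x = 1 \<and> (\<forall>h\<in>F. \<forall>y. p (act h y) * p y = 0)" for x
  proof -
    have "\<exists>V. open V \<and> x \<in> V \<and> (\<forall>y\<in>V. act h y \<notin> V)" if "h \<in> F" for h
    proof -
      have "h \<noteq> 0" using that F(2) by blast
      then have "act h x \<noteq> x" using free by (auto simp: free_action_def)
      then obtain A B where AB: "open A" "open B" "act h x \<in> A" "x \<in> B" "A \<inter> B = {}"
        using hausdorff[OF \<open>act h x \<noteq> x\<close>] by blast
      have "continuous_on UNIV (act h)"
        using action by (auto simp: action_by_homeomorphisms_def homeomorphism_def)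
      then have "open (act h -` A)" using AB(1) by (simp add: open_vimage)
      then show ?thesis using AB by (intro exI[of _ "B \<inter> act h -` A"]) auto
    qed
    then obtain V where V: "\<And>h. h \<in> F \<Longrightarrow> open (V h)" "\<And>h. h \<in> F \<Longrightarrow> x \<in> V h"
      "\<And>h y. h \<in> F \<Longrightarrow> y \<in> V h \<Longrightarrow> act h y \<notin> V h" by metis
    have "open (\<Inter>h\<in>F. V h)" "x \<in> (\<Inter>h\<in>F. V h)" using V F(1) by auto
    then obtain p :: "'x \<Rightarrow> real" where p: "continuous_on UNIV p" "p x = 1"
      "\<And>y. y \<notin> (\<Inter>h\<in>F. V h) \<Longrightarrow> p y = 0" using urysohn_function[of "\<Inter>h\<in>F. V h" x] by metis
    have "p (act h y) * p y = 0" if "h \<in> F" for h y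
      using p(3)[of y] p(3)[of "act h y"] V(3)[OF that, of y] that by auto
    then show ?thesis using p by blast
  qed
  then obtain p :: "'x \<Rightarrow> 'x \<Rightarrow> real" where p: "\<And>i. continuous_on UNIV (p i)" "\<And>i. p i i = 1"
    "\<And>i h y. h \<in> F \<Longrightarrow> p i (act h y) * p i y = 0" by metis
  have "open {y. p i y \<noteq> 0}" for i by (intro open_Collect_neq continuous_intros p)
  moreover have "UNIV \<subseteq> (\<Union>i\<in>UNIV. {y. p i y \<noteq> 0})" using p(2) by (auto intro!: exI[of "\<lambda>i. p i _ \<noteq> 0"])
  ultimately obtain I where I: "finite I" "UNIV \<subseteq> (\<Union>i\<in>I. {y. p i y \<noteq> 0})"
    using compactE_image[OF compact_space, of UNIV "\<lambda>i. {y. p i y \<noteq> 0}"] by metis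
  define s where "s y = (\<Sum>i\<in>I. (p i y)\<^sup>2)" for y
  have s: "s y > 0" for y
  proof -
    obtain i where "i \<in> I" "p i y \<noteq> 0" using I(2) by blast
    then show ?thesis unfolding s_def by (intro sum_pos2[OF I(1)]) auto
  qed
  show thesis
  proof
    show "finite I" by fact
    show "continuous_on UNIV (\<lambda>y. p i y / sqrt (s y))" for i
      using s unfolding s_def by (intro continuous_intros p) (metis less_irrefl real_sqrt_eq_zero_cancel_iff)
    show "(\<Sum>i\<in>I. (p i y / sqrt (s y))\<^sup>2) = 1" for y
    proof -
      have "(\<Sum>i\<in>I. (p i y / sqrt (s y))\<^sup>2) = (\<Sum>i\<in>I. (p i y)\<^sup>2 / s y)"
        using s[of y] by (simp add: power_divide)
      also have "\<dots> = 1" using s[of y] by (simp add: sum_divide_distrib[symmetric] s_def)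
      finally show ?thesis .
    qed
    show "p i (act h y) / sqrt (s (act h y)) * (p i y / sqrt (s y)) = 0" if "h \<in> F" for i h y
      using p(3)[OF that, of i y] by auto
  qed
qed


section \<open>Slices of the members of an intermediate algebra\<close>
definition mult_op :: "('x \<Rightarrow> real) \<Rightarrow> ('g \<times> 'x) op" where
  "mult_op k = slice act 0 (\<lambda>x. of_real (k x))"

lemma inner_mult_op:
  assumes "continuous_on UNIV k"
  shows "inner (blinfun_apply (mult_op k) \<xi>) \<eta> = inner \<xi> (blinfun_apply (mult_op k) \<eta>)"
proof -
  have "continuous_on UNIV (\<lambda>x. complex_of_real (k x))" by (intro continuous_intros assms)
  from is_adjoint_slice[OF this, of 0] have "is_adjoint (mult_op k) (mult_op k)" by (simp add: mult_op_def)
  then show ?thesis by (simp add: is_adjoint_inner)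
qed

lemma sum_norm_mult_op:
  assumes "\<And>i. i \<in> I \<Longrightarrow> continuous_on UNIV (k i)" and "\<And>x. (\<Sum>i\<in>I. (k i x)\<^sup>2) = 1"
  shows "(\<Sum>i\<in>I. (norm (blinfun_apply (mult_op (k i)) \<xi>))\<^sup>2) = (norm \<xi>)\<^sup>2"
proof -
  have cont: "continuous_on UNIV (\<lambda>x. complex_of_real (k i x))" if "i \<in> I" for i
    by (intro continuous_intros assms that)
  have sq: "mult_op (k i) o\<^sub>L mult_op (k i) = slice act 0 (\<lambda>x. (of_real (k i x))\<^sup>2)" if "i \<in> I" for i
    using slice_mult[OF cont cont, OF that that, of 0 0] by (simp add: mult_op_def power2_eq_square)
  have "(\<Sum>i\<in>I. mult_op (k i) o\<^sub>L mult_op (k i)) = slice act 0 (\<lambda>x. \<Sum>i\<in>I. (of_real (k i x))\<^sup>2)"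
    by (subst slice_sum) (auto intro!: continuous_intros assms(1) sum.cong sq)
  also have "(\<lambda>x. \<Sum>i\<in>I. (complex_of_real (k i x))\<^sup>2) = (\<lambda>_. 1)"
  proof
    fix x
    have "(\<Sum>i\<in>I. (complex_of_real (k i x))\<^sup>2) = of_real (\<Sum>i\<in>I. (k i x)\<^sup>2)" by simp
    then show "(\<Sum>i\<in>I. (complex_of_real (k i x))\<^sup>2) = 1" by (simp only: assms(2) of_real_1)
  qed
  also have "slice act 0 (\<lambda>_. 1) = (id_blinfun :: ('g \<times> 'x) op)"
    by (intro blinfun_eqI ell2_eqI) (auto simp: slice_apply)
  finally have "(norm \<xi>)\<^sup>2 = inner \<xi> (blinfun_apply (\<Sum>i\<in>I. mult_op (k i) o\<^sub>L mult_op (k i)) \<xi>)"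
    by (simp add: power2_norm_eq_inner)
  also have "\<dots> = (\<Sum>i\<in>I. (norm (blinfun_apply (mult_op (k i)) \<xi>))\<^sup>2)"
    by (simp add: blinfun.sum_left inner_sum_right power2_norm_eq_inner inner_mult_op assms(1))
  finally show ?thesis ..
qed

text \<open>
  A row contraction times the diagonal of copies of \<open>T\<close> times a column contraction.
\<close>
lemma norm_compression_le:
  assumes k: "\<And>i. i \<in> I \<Longrightarrow> continuous_on UNIV (k i)" "\<And>x. (\<Sum>i\<in>I. (k i x)\<^sup>2) = 1"
    and l: "\<And>i. i \<in> I \<Longrightarrow> continuous_on UNIV (l i)" "\<And>x. (\<Sum>i\<in>I. (l i x)\<^sup>2) = 1"
  shows "norm (\<Sum>i\<in>I. mult_op (k i) o\<^sub>L T o\<^sub>L mult_op (l i)) \<le> norm T"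
proof (rule norm_blinfun_bound)
  fix \<xi>
  let ?\<eta> = "blinfun_apply (\<Sum>i\<in>I. mult_op (k i) o\<^sub>L T o\<^sub>L mult_op (l i)) \<xi>"
  define u where "u i = norm (blinfun_apply (mult_op (k i)) ?\<eta>)" for i
  define v where "v i = norm (blinfun_apply (mult_op (l i)) \<xi>)" for i
  have "(norm ?\<eta>)\<^sup>2 = inner ?\<eta> ?\<eta>" by (rule power2_norm_eq_inner)
  also have "\<dots> = (\<Sum>i\<in>I. inner ?\<eta> (blinfun_apply (mult_op (k i)) (blinfun_apply T (blinfun_apply (mult_op (l i)) \<xi>))))"
    by (subst (2) blinfun.sum_left) (simp add: inner_sum_right)
  also have "\<dots> = (\<Sum>i\<in>I. inner (blinfun_apply (mult_op (k i)) ?\<eta>) (blinfun_apply T (blinfun_apply (mult_op (l i)) \<xi>)))"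
    by (intro sum.cong refl inner_mult_op[symmetric] k)
  also have "\<dots> \<le> (\<Sum>i\<in>I. u i * (norm T * v i))"
    unfolding u_def v_def
    by (intro sum_mono order_trans[OF norm_cauchy_schwarz] mult_left_mono norm_blinfun) auto
  also have "\<dots> = norm T * (\<Sum>i\<in>I. \<bar>u i\<bar> * \<bar>v i\<bar>)"
    by (simp add: sum_distrib_left u_def v_def mult.left_commute)
  also have "\<dots> \<le> norm T * (L2_set u I * L2_set v I)" by (intro mult_left_mono L2_set_mult_ineq) auto
  also have "L2_set u I = norm ?\<eta>" by (simp add: L2_set_def u_def sum_norm_mult_op[OF k])
  also have "L2_set v I = norm \<xi>" by (simp add: L2_set_def v_def sum_norm_mult_op[OF l])
  finally have "norm ?\<eta> * norm ?\<eta> \<le> (norm T * norm \<xi>) * norm ?\<eta>"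
    by (simp add: power2_eq_square mult_ac)
  then show "norm ?\<eta> \<le> norm T * norm \<xi>"
    by (cases "norm ?\<eta> = 0") (auto simp: mult_le_cancel_right zero_le_mult_iff)
qed simp

end

locale intermediate_algebra = compact_action act
  for act :: "'g::group_add \<Rightarrow> 'x::t2_space \<Rightarrow> 'x" +
  fixes B :: "('g \<times> 'x) op set"
  assumes cstar: "cstar_subalgebra B" and CX_B: "CX act \<subseteq> B" and B_crossed: "B \<subseteq> reduced_crossed_product act"
begin

lemma closed_B: "closed B" and subspace_B: "op_subspace B"
  and mult_B: "S \<in> B \<Longrightarrow> T \<in> B \<Longrightarrow> S o\<^sub>L T \<in> B"
  and adjoint_B: "T \<in> B \<Longrightarrow> \<exists>S\<in>B. is_adjoint T S"
  using cstar by (auto simp: cstar_subalgebra_def)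

lemma slice_0_B: "continuous_on UNIV f \<Longrightarrow> slice act 0 f \<in> B"
  using CX_B by (auto simp: CX_def slice_0)

text \<open>
  Compressing by \<open>l\<^sub>i \<circ> g\<^sup>-\<^sup>1\<close> on the left and \<open>l\<^sub>i\<close> on the right multiplies the slice at \<open>h\<close> by the sum of the
  \<open>l\<^sub>i (g\<^sup>-\<^sup>1h x) l\<^sub>i x\<close>.  This sum is \<open>1\<close> for \<open>h = g\<close>, and for finitely many other \<open>h\<close> it is made to vanish by
  freeness.  The compression maps \<open>B\<close> to itself and is contractive, so the remaining slices of \<open>T\<close>
  contribute little.
\<close>
lemma slice_coef_in_B:
  assumes free: "free_action act" and T: "T \<in> B"
  shows "slice act g (coef T g) \<in> B"
proof -
  have T': "T \<in> reduced_crossed_product act" using T B_crossed by blast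
  have "\<exists>S\<in>B. dist S (slice act g (coef T g)) < e" if "e > 0" for e
  proof -
    obtain R where R: "R \<in> algebraic_crossed_product" "norm (T - R) < e/2"
      using crossed_product_approx[OF T', of "e/2"] \<open>e > 0\<close> by auto
    obtain F where F: "finite F" "\<And>g. continuous_on UNIV (coef R g)"
      "\<And>g x. g \<notin> F \<Longrightarrow> coef R g x = 0" "R = (\<Sum>h\<in>F. slice act h (coef R h))"
      using alg_expansion[OF R(1)] by blast
    define F' where "F' = (\<lambda>h. - g + h) ` (F - {g})"
    have "0 \<notin> F'"
      unfolding F'_def by (metis (no_types, lifting) DiffE add.right_neutral imageE insertI1 minus_add_cancel add_minus_cancel)
    moreover have "finite F'" using F(1) by (simp add: F'_def)
    ultimately obtain I and l :: "'x \<Rightarrow> 'x \<Rightarrow> real" where I: "finite I"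
      and l: "\<And>i. continuous_on UNIV (l i)" "\<And>x. (\<Sum>i\<in>I. (l i x)\<^sup>2) = 1"
        "\<And>i h x. h \<in> F' \<Longrightarrow> l i (act h x) * l i x = 0"
      using moving_partition[OF free] by blast
    define k where "k i x = l i (act (- g) x)" for i x
    have k: "continuous_on UNIV (k i)" "(\<Sum>i\<in>I. (k i x)\<^sup>2) = 1" for i x
      unfolding k_def by (intro continuous_on_comp_act l)+
    define \<Phi> where "\<Phi> S = (\<Sum>i\<in>I. mult_op (k i) o\<^sub>L S o\<^sub>L mult_op (l i))" for S
    have norm_\<Phi>: "norm (\<Phi> S) \<le> norm S" for S
      unfolding \<Phi>_def by (intro norm_compression_le k l)
    have \<Phi>_diff: "\<Phi> (S - S') = \<Phi> S - \<Phi> S'" for S S'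
      by (simp add: \<Phi>_def compose.diff_left compose.diff_right sum_subtractf)
    have \<Phi>_sum: "\<Phi> (\<Sum>h\<in>F. s h) = (\<Sum>h\<in>F. \<Phi> (s h))" for s
      unfolding \<Phi>_def compose.sum_left compose.sum_right by (rule sum.swap)
    have "\<Phi> T \<in> B"
      unfolding \<Phi>_def mult_op_def
      by (intro op.subspace_sum[OF subspace_B] mult_B slice_0_B T continuous_intros k l)
    have \<Phi>_slice: "\<Phi> (slice act h a) = slice act h (\<lambda>x. \<Sum>i\<in>I. of_real (l i (act (- g + h) x) * l i x) * a x)"
      if a: "continuous_on UNIV a" for h a
    proof -
      have ck: "continuous_on UNIV (\<lambda>x. complex_of_real (k i x))"
        and cl: "continuous_on UNIV (\<lambda>x. complex_of_real (l i x))" for i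
        by (intro continuous_intros k l)+
      have "mult_op (k i) o\<^sub>L slice act h a = slice act h (\<lambda>x. of_real (k i (act h x)) * a x)" for i
        using slice_mult[OF ck a, where g=0 and h=h] by (simp add: mult_op_def)
      moreover have "continuous_on UNIV (\<lambda>x. complex_of_real (k i (act h x)) * a x)" for i
        by (intro continuous_intros a continuous_on_comp_act k)
      ultimately have "mult_op (k i) o\<^sub>L slice act h a o\<^sub>L mult_op (l i)
          = slice act h (\<lambda>x. of_real (k i (act h x)) * a x * of_real (l i x))" for i
        using slice_mult[OF _ cl, where g=h and h=0] by (simp add: mult_op_def)
      then show ?thesis
        unfolding \<Phi>_def
        by (subst slice_sum)
          (auto intro!: continuous_intros a continuous_on_comp_act l sum.cong simp: k_def act_add mult_ac)
    qed
    have \<Phi>_other: "\<Phi> (slice act h (coef R h)) = 0" if "h \<in> F" "h \<noteq> g" for h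
    proof -
      have "- g + h \<in> F'" using that by (auto simp: F'_def)
      then show ?thesis by (simp add: \<Phi>_slice[OF F(2)] l(3) slice_zero_fun del: of_real_mult)
    qed
    have \<Phi>_same: "\<Phi> (slice act g (coef R g)) = slice act g (coef R g)"
    proof -
      have "(\<Sum>i\<in>I. complex_of_real (l i x * l i x) * a) = a" for x a
        using l(2)[of x] by (simp add: sum_distrib_right[symmetric] of_real_sum[symmetric] power2_eq_square del: of_real_mult)
      then show ?thesis by (simp add: \<Phi>_slice[OF F(2)] del: of_real_mult)
    qed
    have "\<Phi> R = slice act g (coef R g)"
    proof (cases "g \<in> F")
      case True
      have "\<Phi> R = (\<Sum>h\<in>F. \<Phi> (slice act h (coef R h)))" by (subst F(4)) (rule \<Phi>_sum)
      also have "\<dots> = (\<Sum>h\<in>{g}. \<Phi> (slice act h (coef R h)))"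
        using F(1) True by (intro sum.mono_neutral_right) (auto simp: \<Phi>_other)
      finally show ?thesis by (simp add: \<Phi>_same)
    next
      case False
      have "\<Phi> R = (\<Sum>h\<in>F. \<Phi> (slice act h (coef R h)))" by (subst F(4)) (rule \<Phi>_sum)
      also have "\<dots> = 0" using False by (intro sum.neutral ballI \<Phi>_other) auto
      also have "0 = slice act g (coef R g)"
      proof -
        have "coef R g = (\<lambda>_. 0)" using F(3)[OF False] by blast
        then show ?thesis by (simp add: slice_zero_fun)
      qed
      finally show ?thesis .
    qed
    moreover have "slice act g (coef (T - R) g) = slice act g (coef T g) - slice act g (coef R g)"
      using slice_diff[OF continuous_coef[OF T'] F(2), of g g g] by (simp add: coef_diff[abs_def])
    ultimately have eq: "\<Phi> T - slice act g (coef T g) = \<Phi> (T - R) - slice act g (coef (T - R) g)"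
      by (simp add: \<Phi>_diff)
    have "continuous_on UNIV (coef (T - R) g)"
      using continuous_on_diff[OF continuous_coef[OF T'] F(2)] by (simp add: coef_diff[abs_def])
    then have "norm (slice act g (coef (T - R) g)) \<le> norm (T - R)" by (intro norm_slice_le cmod_coef_le)
    then have "norm (\<Phi> T - slice act g (coef T g)) < e"
      unfolding eq using norm_triangle_ineq4[of "\<Phi> (T - R)" "slice act g (coef (T - R) g)"]
        norm_\<Phi>[of "T - R"] R(2) by linarith
    then show ?thesis using \<open>\<Phi> T \<in> B\<close> by (auto simp: dist_norm)
  qed
  then have "slice act g (coef T g) \<in> closure B" by (simp add: closure_approachable)
  then show ?thesis using closed_B by simp
qed

lemma slice_in_B:
  assumes f: "continuous_on UNIV f"
    and D: "\<And>x. f x \<noteq> 0 \<Longrightarrow> \<exists>d. continuous_on UNIV d \<and> slice act g d \<in> B \<and> d x \<noteq> 0"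
  shows "slice act g f \<in> B"
proof -
  let ?D = "{d. continuous_on UNIV d \<and> slice act g d \<in> B}"
  have mult: "(\<lambda>x. d x * k x) \<in> ?D" if "d \<in> ?D" "continuous_on UNIV k" for d k
    using mult_B[OF _ slice_0_B, of "slice act g d" k] slice_mult[of d k g 0] that
    by (auto intro: continuous_on_mult)
  have "\<exists>S\<in>B. dist S (slice act g f) < e" if "e > 0" for e
  proof -
    have "\<exists>d\<in>?D. \<forall>x. cmod (f x - d x) \<le> e/2"
    proof (rule ideal_approx[OF _ _ _ mult f])
      show "(\<lambda>_. 0) \<in> ?D" using op.subspace_0[OF subspace_B] by (simp add: slice_zero_fun)
      show "(\<lambda>x. d x + d' x) \<in> ?D" if "d \<in> ?D" "d' \<in> ?D" for d d'
        using that op.subspace_add[OF subspace_B] by (auto simp: slice_add intro: continuous_on_add)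
    qed (use D \<open>e > 0\<close> in auto)
    then obtain d where d: "continuous_on UNIV d" "slice act g d \<in> B" "\<And>x. cmod (f x - d x) \<le> e/2" by blast
    have "norm (slice act g f - slice act g d) \<le> e/2"
      using norm_slice_le[OF continuous_on_diff[OF f d(1)], of "e/2" g] d(3) by (simp add: slice_diff f d(1))
    then show ?thesis using d(2) \<open>e > 0\<close> by (intro bexI[of _ "slice act g d"]) (auto simp: dist_norm norm_minus_commute)
  qed
  then have "slice act g f \<in> closure B" by (simp add: closure_approachable)
  then show ?thesis using closed_B by simp
qed

end


section \<open>Open subgroupoids and intermediate algebras\<close>
lemma groupoid_open_iff: "groupoid_open H \<longleftrightarrow> (\<forall>g. open (fibre g H))"
proof
  assume H: "groupoid_open H"
  show "\<forall>g. open (fibre g H)"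
  proof
    fix g
    show "open (fibre g H)"
    proof (rule topological_space_class.openI)
      fix x assume "x \<in> fibre g H"
      then have "(g, x) \<in> H" by (simp add: fibre_def)
      then obtain U V where "open V" "g \<in> U" "x \<in> V" "U \<times> V \<subseteq> H"
        using H[unfolded groupoid_open_def openin_prod_topology_alt, rule_format, of g x] by auto
      then show "\<exists>T. open T \<and> x \<in> T \<and> T \<subseteq> fibre g H"
        by (intro exI[of _ V]) (auto simp: fibre_def)
    qed
  qed
next
  assume *: "\<forall>g. open (fibre g H)"
  show "groupoid_open H"
    unfolding groupoid_open_def openin_prod_topology_alt
  proof (intro allI impI)
    fix g x assume "(g, x) \<in> H"
    then show "\<exists>U V. openin (discrete_topology UNIV) U \<and> openin euclidean V \<and> g \<in> U \<and> x \<in> V \<and> U \<times> V \<subseteq> H"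
      using * by (intro exI[of _ "{g}"] exI[of _ "fibre g H"]) (auto simp: fibre_def)
  qed
qed

text \<open>
  For fixed \<open>g\<close> and \<open>x\<close> the coefficient is a bounded functional, so its vanishing passes from a set of
  operators to the closure.
\<close>
lemma continuous_on_coef_op: "continuous_on UNIV (\<lambda>T. coef T g x)"
proof -
  have "bounded_linear (\<lambda>T. coef T g x)"
    by (rule bounded_linear_intro[where K=1])
      (auto simp: coef_add cmod_coef_le op_scaleC_of_real[symmetric] coef_scaleC scaleR_conv_of_real)
  then show ?thesis by (rule bounded_linear.continuous_on) (rule continuous_on_id)
qed

definition supported_slices :: "('g::group_add \<Rightarrow> 'x::topological_space \<Rightarrow> 'x) \<Rightarrow> ('g \<times> 'x) set \<Rightarrow> ('g \<times> 'x) op set" where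
  "supported_slices act H = {slice act g f | g f. continuous_on UNIV f \<and> supp f \<subseteq> fibre g H}"

definition groupoid_algebra :: "('g::group_add \<Rightarrow> 'x::topological_space \<Rightarrow> 'x) \<Rightarrow> ('g \<times> 'x) set \<Rightarrow> ('g \<times> 'x) op set" where
  "groupoid_algebra act H = closure (op_span (supported_slices act H))"

text \<open>
  The inverse of the correspondence.
\<close>
definition arrow_support :: "('g::group_add \<times> 'x) op set \<Rightarrow> ('g \<times> 'x) set" where
  "arrow_support B = {(g, x). \<exists>T\<in>B. coef T g x \<noteq> 0}"

context compact_action
begin

lemma slice_in_groupoid_algebra:
  "continuous_on UNIV f \<Longrightarrow> supp f \<subseteq> fibre g H \<Longrightarrow> slice act g f \<in> groupoid_algebra act H"
  unfolding groupoid_algebra_def supported_slices_def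
  by (intro closure_subset[THEN subsetD] op.span_base) blast

lemma cstar_groupoid_algebra:
  assumes H: "subgroupoid act H"
  shows "cstar_subalgebra (groupoid_algebra act H)"
  unfolding groupoid_algebra_def
proof (rule cstar_subalgebra_closure_span)
  fix S T assume "S \<in> supported_slices act H" "T \<in> supported_slices act H"
  then obtain g f h k where S: "S = slice act g f" "continuous_on UNIV f" "supp f \<subseteq> fibre g H"
    and T: "T = slice act h k" "continuous_on UNIV k" "supp k \<subseteq> fibre h H"
    by (auto simp: supported_slices_def)
  have "continuous_on UNIV (\<lambda>x. f (act h x) * k x)"
    by (intro continuous_on_mult continuous_on_comp_act S T)
  moreover have "supp (\<lambda>x. f (act h x) * k x) \<subseteq> fibre (g + h) H"
  proof
    fix x assume "x \<in> supp (\<lambda>x. f (act h x) * k x)"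
    then have "(g, act h x) \<in> H" "(h, x) \<in> H" using S(3) T(3) by (auto simp: supp_def fibre_def)
    then show "x \<in> fibre (g + h) H" using H by (simp add: subgroupoid_def fibre_def)
  qed
  ultimately show "S o\<^sub>L T \<in> supported_slices act H"
    unfolding S(1) T(1) slice_mult[OF S(2) T(2)] supported_slices_def by blast
next
  fix T assume "T \<in> supported_slices act H"
  then obtain g f where T: "T = slice act g f" "continuous_on UNIV f" "supp f \<subseteq> fibre g H"
    by (auto simp: supported_slices_def)
  have "continuous_on UNIV (\<lambda>x. cnj (f (act (- g) x)))"
    by (intro continuous_on_cnj continuous_on_comp_act T)
  moreover have "supp (\<lambda>x. cnj (f (act (- g) x))) \<subseteq> fibre (- g) H"
  proof
    fix x assume "x \<in> supp (\<lambda>x. cnj (f (act (- g) x)))"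
    then have "(g, act (- g) x) \<in> H" using T(3) by (auto simp: supp_def fibre_def)
    then have "(- g, act g (act (- g) x)) \<in> H" using H unfolding subgroupoid_def by blast
    then show "x \<in> fibre (- g) H" by (simp add: fibre_def)
  qed
  ultimately show "\<exists>S\<in>supported_slices act H. is_adjoint T S"
    using is_adjoint_slice[OF T(2), of g] unfolding T(1) supported_slices_def by blast
qed

lemma CX_subset_groupoid_algebra:
  assumes "{0} \<times> UNIV \<subseteq> H"
  shows "CX act \<subseteq> groupoid_algebra act H"
proof -
  have "fibre 0 H = UNIV" using assms by (auto simp: fibre_def)
  then show ?thesis
    using slice_in_groupoid_algebra[of _ 0 H] by (auto simp: CX_def slice_0[symmetric])
qed

lemma groupoid_algebra_subset: "groupoid_algebra act H \<subseteq> reduced_crossed_product act"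
  unfolding groupoid_algebra_def reduced_crossed_product_eq algebraic_crossed_product_def supported_slices_def
  by (intro closure_mono op.span_mono) blast

lemma coef_groupoid_algebra:
  assumes "T \<in> groupoid_algebra act H" "x \<notin> fibre g H"
  shows "coef T g x = 0"
proof -
  have "op_span (supported_slices act H) \<subseteq> {T. coef T g x = 0}"
  proof (rule op.span_minimal)
    show "supported_slices act H \<subseteq> {T. coef T g x = 0}"
      using assms(2) by (auto simp: supported_slices_def coef_slice supp_def)
    show "op_subspace {T. coef T g x = 0}"
      by (auto simp: op.subspace_def coef_zero coef_add coef_scaleC)
  qed
  moreover have "closed {T :: ('g \<times> 'x) op. coef T g x = 0}"
    by (intro closed_Collect_eq continuous_on_coef_op continuous_on_const)
  ultimately have "groupoid_algebra act H \<subseteq> {T. coef T g x = 0}"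
    unfolding groupoid_algebra_def by (rule closure_minimal)
  then show ?thesis using assms(1) by blast
qed

text \<open>
  Each arrow \<open>(g, x)\<close> of an open \<open>H\<close> is detected by a slice \<open>u\<^sub>g f\<close> with \<open>f x = 1\<close> that is supported in \<open>H\<close>.
\<close>
lemma arrow_support_groupoid_algebra:
  assumes H: "groupoid_open H"
  shows "arrow_support (groupoid_algebra act H) = H"
proof (intro equalityI subsetI)
  fix z assume "z \<in> arrow_support (groupoid_algebra act H)"
  then show "z \<in> H" using coef_groupoid_algebra by (auto simp: arrow_support_def fibre_def)
next
  fix z assume z: "z \<in> H"
  obtain g x where gx: "z = (g, x)" by (cases z)
  then have "open (fibre g H)" "x \<in> fibre g H" using H z by (auto simp: groupoid_open_iff fibre_def)
  then obtain f :: "'x \<Rightarrow> real" where f: "continuous_on UNIV f" "f x = 1" "\<And>y. y \<notin> fibre g H \<Longrightarrow> f y = 0"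
    using urysohn_function[of "fibre g H" x] by metis
  have f': "continuous_on UNIV (\<lambda>y. complex_of_real (f y))" by (intro continuous_intros f)
  have "slice act g (\<lambda>y. of_real (f y)) \<in> groupoid_algebra act H"
    using f(3) by (intro slice_in_groupoid_algebra f') (auto simp: supp_def)
  moreover have "coef (slice act g (\<lambda>y. of_real (f y))) g x \<noteq> 0" by (simp add: coef_slice[OF f'] f(2))
  ultimately show "z \<in> arrow_support (groupoid_algebra act H)" unfolding gx arrow_support_def by blast
qed

end

context intermediate_algebra
begin

lemma groupoid_open_arrow_support: "groupoid_open (arrow_support B)"
proof -
  have "fibre g (arrow_support B) = (\<Union>T\<in>B. {x. coef T g x \<noteq> 0})" for g
    by (auto simp: fibre_def arrow_support_def)
  moreover have "open {x. coef T g x \<noteq> 0}" if "T \<in> B" for T g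
    using that B_crossed by (intro open_Collect_neq continuous_coef continuous_on_const) auto
  ultimately show ?thesis by (auto simp: groupoid_open_iff)
qed

lemma units_arrow_support: "{0} \<times> UNIV \<subseteq> arrow_support B"
proof -
  have "coef (slice act 0 (\<lambda>_. 1)) 0 x \<noteq> 0" for x by (simp add: coef_slice)
  moreover have "slice act 0 (\<lambda>_. 1) \<in> B" by (intro slice_0_B continuous_on_const)
  ultimately show ?thesis by (auto simp: arrow_support_def)
qed

text \<open>
  Since the slices of members of \<open>B\<close> are in \<open>B\<close>, an arrow of the support is seen by a single slice in \<open>B\<close>,
  and products and adjoints of single slices are again slices over the product and inverse arrows.
\<close>
lemma subgroupoid_arrow_support:
  assumes free: "free_action act"
  shows "subgroupoid act (arrow_support B)"
proof -
  have wit: "\<exists>f. continuous_on UNIV f \<and> slice act g f \<in> B \<and> f x \<noteq> 0" if gx: "(g, x) \<in> arrow_support B" for g x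
  proof -
    obtain T where T: "T \<in> B" "coef T g x \<noteq> 0" using gx by (auto simp: arrow_support_def)
    have "continuous_on UNIV (coef T g)" using T(1) B_crossed by (intro continuous_coef) blast
    then show ?thesis using slice_coef_in_B[OF free T(1)] T(2) by blast
  qed
  show ?thesis
    unfolding subgroupoid_def
  proof (intro conjI allI impI)
    fix g x assume "(g, x) \<in> arrow_support B"
    then obtain f where f: "continuous_on UNIV f" "slice act g f \<in> B" "f x \<noteq> 0" using wit by blast
    let ?k = "\<lambda>y. cnj (f (act (- g) y))"
    have k: "continuous_on UNIV ?k" by (intro continuous_on_cnj continuous_on_comp_act f)
    obtain S where "S \<in> B" "is_adjoint (slice act g f) S" using adjoint_B[OF f(2)] by blast
    then have "slice act (- g) ?k \<in> B" using is_adjoint_unique[OF is_adjoint_slice[OF f(1), of g]] by metis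
    moreover have "coef (slice act (- g) ?k) (- g) (act g x) \<noteq> 0" using f(3) by (simp add: coef_slice[OF k])
    ultimately show "(- g, act g x) \<in> arrow_support B" by (auto simp: arrow_support_def)
  next
    fix g h x assume "(g, act h x) \<in> arrow_support B" "(h, x) \<in> arrow_support B"
    then obtain f k where f: "continuous_on UNIV f" "slice act g f \<in> B" "f (act h x) \<noteq> 0"
      and k: "continuous_on UNIV k" "slice act h k \<in> B" "k x \<noteq> 0" using wit by blast
    have fk: "continuous_on UNIV (\<lambda>y. f (act h y) * k y)"
      by (intro continuous_on_mult continuous_on_comp_act f k)
    have "slice act (g + h) (\<lambda>y. f (act h y) * k y) \<in> B"
      using mult_B[OF f(2) k(2)] by (simp add: slice_mult f(1) k(1))
    moreover have "coef (slice act (g + h) (\<lambda>y. f (act h y) * k y)) (g + h) x \<noteq> 0"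
      using f(3) k(3) by (simp add: coef_slice[OF fk])
    ultimately show "(g + h, x) \<in> arrow_support B" unfolding arrow_support_def by blast
  qed
qed

text \<open>
  The slices at \<open>g\<close> in \<open>B\<close> form a closed ideal of \<open>C(X)\<close>, which gives one inclusion; the other holds
  because members of \<open>B\<close> are limits of combinations of their own slices.
\<close>
lemma groupoid_algebra_arrow_support:
  assumes AP: "approximation_property TYPE('g)" and free: "free_action act"
  shows "groupoid_algebra act (arrow_support B) = B"
proof (intro equalityI subsetI)
  have "slice act g f \<in> B" if f: "continuous_on UNIV f" "supp f \<subseteq> fibre g (arrow_support B)" for g f
  proof (rule slice_in_B[OF f(1)])
    fix x assume "f x \<noteq> 0"
    then obtain T where T: "T \<in> B" "coef T g x \<noteq> 0"
      using f(2) by (auto simp: supp_def fibre_def arrow_support_def)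
    have "continuous_on UNIV (coef T g)" using T(1) B_crossed by (intro continuous_coef) blast
    then show "\<exists>d. continuous_on UNIV d \<and> slice act g d \<in> B \<and> d x \<noteq> 0"
      using slice_coef_in_B[OF free T(1)] T(2) by blast
  qed
  then have "op_span (supported_slices act (arrow_support B)) \<subseteq> B"
    by (intro op.span_minimal subspace_B) (auto simp: supported_slices_def)
  then have "groupoid_algebra act (arrow_support B) \<subseteq> B"
    unfolding groupoid_algebra_def by (rule closure_minimal[OF _ closed_B])
  then show "T \<in> B" if "T \<in> groupoid_algebra act (arrow_support B)" for T using that by blast
next
  fix T assume T: "T \<in> B"
  then have T': "T \<in> reduced_crossed_product act" using B_crossed by blast
  have "op_span (range (\<lambda>g. slice act g (coef T g))) \<subseteq> op_span (supported_slices act (arrow_support B))"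
    using T continuous_coef[OF T']
    by (intro op.span_mono) (auto simp: supported_slices_def supp_def fibre_def arrow_support_def)
  then show "T \<in> groupoid_algebra act (arrow_support B)"
    using in_closure_span_slice_coef[OF AP T'] unfolding groupoid_algebra_def by (meson closure_mono subsetD)
qed

end

theorem corollary5p8:
  fixes act :: "'g::group_add \<Rightarrow> 'x::t2_space \<Rightarrow> 'x"
  assumes "approximation_property TYPE('g)"
    and "compact (UNIV :: 'x set)"
    and "action_by_homeomorphisms act"
    and "free_action act"
  shows "bij_betw
    (\<lambda>H. closure (op_span {unitary_op g o\<^sub>L func_op act f | g f.
            continuous_on UNIV f \<and> supp f \<subseteq> fibre g H}))
    {H. subgroupoid act H \<and> groupoid_open H \<and> {0} \<times> UNIV \<subseteq> H}
    {B. cstar_subalgebra B \<and> CX act \<subseteq> B \<and> B \<subseteq> reduced_crossed_product act}"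
proof -
  interpret compact_action act by standard (rule assms)+
  have "bij_betw (groupoid_algebra act)
    {H. subgroupoid act H \<and> groupoid_open H \<and> {0} \<times> UNIV \<subseteq> H}
    {B. cstar_subalgebra B \<and> CX act \<subseteq> B \<and> B \<subseteq> reduced_crossed_product act}"
  proof (rule bij_betw_byWitness[where f'=arrow_support])
    have "intermediate_algebra act B" if "cstar_subalgebra B" "CX act \<subseteq> B" "B \<subseteq> reduced_crossed_product act" for B
      using that by unfold_locales
    note inter = intermediate_algebra.groupoid_algebra_arrow_support[OF this]
      intermediate_algebra.subgroupoid_arrow_support[OF this]
      intermediate_algebra.groupoid_open_arrow_support[OF this]
      intermediate_algebra.units_arrow_support[OF this]
    show "\<forall>B\<in>{B. cstar_subalgebra B \<and> CX act \<subseteq> B \<and> B \<subseteq> reduced_crossed_product act}.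
        groupoid_algebra act (arrow_support B) = B"
      using inter(1) assms by auto
    show "arrow_support ` {B. cstar_subalgebra B \<and> CX act \<subseteq> B \<and> B \<subseteq> reduced_crossed_product act}
        \<subseteq> {H. subgroupoid act H \<and> groupoid_open H \<and> {0} \<times> UNIV \<subseteq> H}"
      using inter(2-) assms(4) by blast
  qed (use arrow_support_groupoid_algebra cstar_groupoid_algebra CX_subset_groupoid_algebra
      groupoid_algebra_subset in blast)+
  then show ?thesis
    by (simp only: groupoid_algebra_def[abs_def] supported_slices_def slice_def)
qed

end
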